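(* For a weak composition $s$ let $f_s(t)=\sum_{F\in\operatorname{Perm}(s)}t^{\dim(F)}$ be the $f$-polynomial of the $s$-permutahedron. If $s$ is a weak composition of length $1$, then $f_s(t)=1$. If $s$ is a weak composition of length $n\ge 2$, write $s=(\tilde s,u,v)$ where $\tilde s$ is the sequence obtained by removing the last two values of $s$, $u=s(n-1)$ and $v=s(n)$. Then (1) if $n>2$ and $u=0$, then $f_s=f_{(\tilde s,v)}\,f_{(0,v)}$; (2) if $n=2$ or $u>0$, then $f_s(t)=(v+1)f_{(\tilde s,u+v)}(t)+v\,t\,f_{(\tilde s,u+v-1)}(t)$, where the second summand is read as $0$ when $v=0$.
   Context: A weak composition of length $n$ is a sequence $s=(s(1),\dots,s(n))$ of non-negative integers. An $s$-decreasing tree is a rooted planar tree with $n$ internal nodes labeled bijectively by $1,\dots,n$ (leaves are unlabeled) such that node $i$ has exactly $s(i)+1$ ordered children and labels decrease from root to leaves. For a node $y$ of such a tree $T$ with $s(y)=m$, let $T^y_0,\dots,T^y_m$ be the children of $y$ from left to right, where "child" means the whole subtree; a child is empty if it is just a leaf. $T^y_0$ is the left child and $T^y_m$ the right child. A descendant of $y$ is a node lying in one of the $T^y_i$. Tree-inversions: for nodes $a<c$, $\#_T(c,a)$ is $0$ if $a$ is left of $c$ or belongs to $T^c_0$; it is $i$ if $a$ belongs to $T^c_i$ with $0<i<s(c)$; it is $s(c)$ if $a$ belongs to $T^c_{s(c)}$ or is right of $c$. $\operatorname{inv}(T)$ is the multi-set in which $(c,a)$ occurs $\#_T(c,a)$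 times; it determines $T$. The $s$-weak order: $R\preccurlyeq T$ iff $\#_R(c,a)\le \#_T(c,a)$ for all $a<c$. Intervals are $[T_1,T_2]=\{R: T_1\preccurlyeq R\preccurlyeq T_2\}$. Transitive closure: for a multi-set $I$ of pairs $(c,a)$, $a<c$, with multiplicities $\#_I(c,a)$, a transitivity path from $c$ to $a$ is a list $c=b_1>\dots>b_k=a$, $k\ge2$, with $\#_I(b_i,b_{i+1})>0$ for all $i$; $\#_{I^{\mathsf{tc}}}(c,a)$ is the maximal value of $\#_I(b_1,b_2)$ over all such paths (and $0$ if there is none). A pair $(a,c)$ with $a<c$ is a tree-ascent of $T$ if: (i) $a$ is a descendant of $c$; (ii) $a$ does not belong to the right child of $c$; (iii) whenever $c>b>a$ and $a$ is a descendant of $b$, $a$ belongs to the right child of $b$; (iv) if $s(a)>0$, the right child of $a$ is empty. For a (possibly empty) set $A$ of tree-ascents of $T$, $T+A$ is the $s$-decreasing tree whose multi-set of tree-inversions is obtained from $\operatorname{inv}(T)$ by increasing $\#_T(c,a)$ by one for every $(a,c)\in A$ and then taking the transitive closure. A pure interval is an interval of the form $[T,T+A]$. The $s$-permutahedron $\operatorname{Perm}(s)$ is the collection of all pure intervals $[T,T+A]$ (its faces); the dimension of $[T,T+A]$ is $|A|$. *)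

theory Defs
  imports "HOL-Computational_Algebra.Polynomial"
begin

(* A weak composition s = (s(1),...,s(n)) is a nat list; entries are numbered from 1. *)

definition entry :: "nat list \<Rightarrow> nat \<Rightarrow> nat" where
  "entry s i = s ! (i - 1)"

datatype ltree = Leaf | Node nat "ltree list"

primrec labels :: "ltree \<Rightarrow> nat list" where
  "labels Leaf = []"
| "labels (Node y ts) = y # concat (map labels ts)"

primrec subtrees :: "ltree \<Rightarrow> ltree set" where
  "subtrees Leaf = {Leaf}"
| "subtrees (Node y ts) = insert (Node y ts) (\<Union> (set (map subtrees ts)))"

definition decreasing_tree :: "nat list \<Rightarrow> ltree \<Rightarrow> bool" where
  "decreasing_tree s T \<longleftrightarrow>
     distinct (labels T) \<and> set (labels T) = {1..length s} \<and>
     (\<forall>y ts. Node y ts \<in> subtrees T \<longrightarrow>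
        length ts = entry s y + 1 \<and> (\<forall>t \<in> set ts. \<forall>a \<in> set (labels t). a < y))"

(* is_child T y i t: the subtree T^y_i is t. *)

definition is_child :: "ltree \<Rightarrow> nat \<Rightarrow> nat \<Rightarrow> ltree \<Rightarrow> bool" where
  "is_child T y i t \<longleftrightarrow> (\<exists>ts. Node y ts \<in> subtrees T \<and> i < length ts \<and> t = ts ! i)"

definition in_child :: "ltree \<Rightarrow> nat \<Rightarrow> nat \<Rightarrow> nat \<Rightarrow> bool" where
  "in_child T y i a \<longleftrightarrow> (\<exists>t. is_child T y i t \<and> a \<in> set (labels t))"

definition descendant :: "ltree \<Rightarrow> nat \<Rightarrow> nat \<Rightarrow> bool" where
  "descendant T a y \<longleftrightarrow> (\<exists>i. in_child T y i a)"

definition left_of :: "ltree \<Rightarrow> nat \<Rightarrow> nat \<Rightarrow> bool" where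
  "left_of T a c \<longleftrightarrow> (\<exists>y i j. i < j \<and> in_child T y i a \<and> in_child T y j c)"

(* Multi-sets of pairs (c,a) with a < c are represented by their multiplicity functions. *)

type_synonym pair_mset = "nat \<Rightarrow> nat \<Rightarrow> nat"

(* If s(c) = 0 the first two cases can overlap, and then agree. *)

definition tree_inv :: "nat list \<Rightarrow> ltree \<Rightarrow> pair_mset" where
  "tree_inv s T c a =
     (if 1 \<le> a \<and> a < c \<and> c \<le> length s then
        if left_of T a c \<or> in_child T c 0 a then 0
        else if in_child T c (entry s c) a \<or> left_of T c a then entry s c
        else (THE i. in_child T c i a)
      else 0)"

definition weak_le :: "nat list \<Rightarrow> ltree \<Rightarrow> ltree \<Rightarrow> bool" where
  "weak_le s R T \<longleftrightarrow>
     (\<forall>a c. 1 \<le> a \<and> a < c \<and> c \<le> length s \<longrightarrow> tree_inv s R c a \<le> tree_inv s T c a)"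

definition interval :: "nat list \<Rightarrow> ltree \<Rightarrow> ltree \<Rightarrow> ltree set" where
  "interval s T1 T2 = {R. decreasing_tree s R \<and> weak_le s T1 R \<and> weak_le s R T2}"

definition transitivity_path :: "pair_mset \<Rightarrow> nat \<Rightarrow> nat \<Rightarrow> nat list \<Rightarrow> bool" where
  "transitivity_path I c a b \<longleftrightarrow>
     2 \<le> length b \<and> hd b = c \<and> last b = a \<and>
     (\<forall>i. i + 1 < length b \<longrightarrow> b ! i > b ! (i + 1) \<and> I (b ! i) (b ! (i + 1)) > 0)"

(* Inserting 0 covers the case of no path; all other elements of the set are positive. *)

definition trans_closure :: "pair_mset \<Rightarrow> pair_mset" where
  "trans_closure I c a = Max (insert 0 {I (b ! 0) (b ! 1) | b. transitivity_path I c a b})"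

definition tree_ascents :: "nat list \<Rightarrow> ltree \<Rightarrow> (nat \<times> nat) set" where
  "tree_ascents s T = {(a, c).
     1 \<le> a \<and> a < c \<and> c \<le> length s \<and>
     descendant T a c \<and>
     \<not> in_child T c (entry s c) a \<and>
     (\<forall>b. c > b \<and> b > a \<and> descendant T a b \<longrightarrow> in_child T b (entry s b) a) \<and>
     (entry s a > 0 \<longrightarrow> is_child T a (entry s a) Leaf)}"

definition tree_plus :: "nat list \<Rightarrow> ltree \<Rightarrow> (nat \<times> nat) set \<Rightarrow> ltree" where
  "tree_plus s T A = (THE R. decreasing_tree s R \<and>
     tree_inv s R = trans_closure (\<lambda>c a. tree_inv s T c a + (if (a, c) \<in> A then 1 else 0)))"

definition Perm :: "nat list \<Rightarrow> ltree set set" where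
  "Perm s = {interval s T (tree_plus s T A) | T A. decreasing_tree s T \<and> A \<subseteq> tree_ascents s T}"

definition face_dim :: "nat list \<Rightarrow> ltree set \<Rightarrow> nat" where
  "face_dim s F = (THE d. \<exists>T A. decreasing_tree s T \<and> A \<subseteq> tree_ascents s T \<and>
     F = interval s T (tree_plus s T A) \<and> d = card A)"

definition f_poly :: "nat list \<Rightarrow> int poly" where
  "f_poly s = (\<Sum>F \<in> Perm s. monom 1 (face_dim s F))"

end

theory Submission
  imports Defs
begin

text \<open>
  Faces are the same as pairs of a tree \<open>T\<close> and a set \<open>A\<close> of tree-ascents of \<open>T\<close>: the tree
  \<open>T + A\<close> exists, \<open>T\<close> is the least element of the pure interval from \<open>T\<close> to \<open>T + A\<close>, and \<open>A\<close>
  consists of the tree-ascents \<open>(a, c)\<close> of \<open>T\<close> at which the inversion number increases from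
  \<open>T\<close> to \<open>T + A\<close> (\<open>pure_interval_inj\<close>). Summing over \<open>A\<close> first gives
  \<open>f\<^sub>s(t) = (\<Sum>T. (1 + t) ^ asc(T))\<close>, where \<open>asc(T)\<close> is the number of tree-ascents
  (\<open>f_poly_ascents\<close>).

  For the existence of \<open>T + A\<close>, a family of numbers \<open>I(c, a) \<le> s(c)\<close> is the family of
  inversion numbers of some tree as soon as, for all \<open>a < b < c\<close>, it is transitive
  (\<open>I(b, a) = 0\<close> or \<open>I(c, b) \<le> I(c, a)\<close>) and planar (\<open>I(b, a) = s(b)\<close> or \<open>I(c, a) \<le> I(c, b)\<close>):
  the root is the largest label, and a label \<open>a\<close> goes to the child of the root with index
  \<open>I(root, a)\<close> (\<open>tree_inv_realise\<close>). A transitive closure is transitive, and planarity of the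
  closure of the raised inversion numbers follows by induction on \<open>c\<close> (\<open>closed_inv_planar\<close>).

  A node \<open>a\<close> is the first component of a tree-ascent if and only if it is off the right spine
  of \<open>T\<close> and either \<open>s(a) = 0\<close> or the right child of \<open>a\<close> is a leaf; the second component is
  then the lowest ancestor of \<open>a\<close> that does not have \<open>a\<close> in its right child. So \<open>asc(T)\<close>
  depends only on the shape of \<open>T\<close> (\<open>card_tree_ascents\<close>).

  The node \<open>n - 1\<close> is a child of the root \<open>n\<close>, at some index \<open>p \<le> v\<close>. Contracting the edge
  between them is a bijection from the trees for \<open>(s', u, v)\<close> to the pairs of a tree for
  \<open>(s', u + v)\<close> and an index \<open>p\<close> (\<open>bij_betw_split_root\<close>). It does not change which nodes
  smaller than \<open>n - 1\<close> contribute to \<open>asc\<close>, and \<open>n - 1\<close> contributes to \<open>asc\<close> if and only if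
  \<open>p < v\<close> and either \<open>u = 0\<close> or the child \<open>p + u\<close> of the contracted root is a leaf
  (\<open>ascent_count_split_root\<close>). Since \<open>p + u < u + v\<close>, this leaf is not the last child of the
  root, and deleting it gives an arbitrary tree for \<open>(s', u + v - 1)\<close> with the same number of
  ascents (\<open>sum_leaf_child\<close>). If \<open>u > 0\<close>, or if \<open>n = 2\<close> and so all children of the contracted
  root are leaves, the condition on \<open>p + u\<close> alone matters: the \<open>v + 1\<close> indices \<open>p\<close> contribute
  one copy each of the polynomial of \<open>(s', u + v)\<close>, and for each of the \<open>v\<close> indices \<open>p < v\<close>
  the trees with a leaf at \<open>p + u\<close> have the factor \<open>1 + t\<close> instead of \<open>1\<close>, which adds \<open>t\<close>
  times the polynomial of \<open>(s', u + v - 1)\<close>. This is the second recurrence. If \<open>u = 0\<close>, every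
  tree has the factor \<open>1 + t\<close> for \<open>p < v\<close>, so that the indices contribute the constant factor
  \<open>1 + v (1 + t)\<close>, which is the polynomial of \<open>(0, v)\<close>.
\<close>

section \<open>Decreasing trees on arbitrary label sets\<close>

text \<open>
  Trees satisfying the local conditions of an \<open>s\<close>-decreasing tree, on an arbitrary set of
  labels. Unlike \<open>decreasing_tree\<close>, this notion passes to subtrees.
\<close>

definition dtree :: "nat list \<Rightarrow> ltree \<Rightarrow> bool" where
  "dtree s T \<longleftrightarrow> distinct (labels T) \<and>
     (\<forall>y ts. Node y ts \<in> subtrees T \<longrightarrow>
        length ts = entry s y + 1 \<and> (\<forall>t \<in> set ts. \<forall>a \<in> set (labels t). a < y))"

lemma decreasing_tree_iff:
  "decreasing_tree s T \<longleftrightarrow> dtree s T \<and> set (labels T) = {1..length s}"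
  unfolding decreasing_tree_def dtree_def by blast

lemma distinct_concat_nth:
  "distinct (concat xss) \<longleftrightarrow> (\<forall>xs\<in>set xss. distinct xs) \<and>
     (\<forall>i<length xss. \<forall>j<length xss. i \<noteq> j \<longrightarrow> set (xss ! i) \<inter> set (xss ! j) = {})"
proof (induction xss)
  case Nil
  show ?case by simp
next
  case (Cons xs xss)
  have 1: "(\<forall>i<length (xs # xss). \<forall>j<length (xs # xss). i \<noteq> j \<longrightarrow>
            set ((xs # xss) ! i) \<inter> set ((xs # xss) ! j) = {}) \<longleftrightarrow>
      (\<forall>j<length xss. set xs \<inter> set (xss ! j) = {}) \<and>
      (\<forall>i<length xss. \<forall>j<length xss. i \<noteq> j \<longrightarrow> set (xss ! i) \<inter> set (xss ! j) = {})"
    (is "?l \<longleftrightarrow> ?r1 \<and> ?r2")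
  proof (intro iffI conjI allI impI)
    fix j assume ?l "j < length xss"
    from this(1)[rule_format, of 0 "Suc j"] this(2) show "set xs \<inter> set (xss ! j) = {}" by simp
  next
    fix i j assume ?l "i < length xss" "j < length xss" "i \<noteq> j"
    from this(1)[rule_format, of "Suc i" "Suc j"] this(2-) show "set (xss ! i) \<inter> set (xss ! j) = {}"
      by simp
  next
    fix i j assume "?r1 \<and> ?r2" "i < length (xs # xss)" "j < length (xs # xss)" "i \<noteq> j"
    then show "set ((xs # xss) ! i) \<inter> set ((xs # xss) ! j) = {}"
      by (cases i; cases j) (simp_all add: Int_commute)
  qed
  have 2: "(\<forall>j<length xss. set xs \<inter> set (xss ! j) = {}) \<longleftrightarrow> set xs \<inter> set (concat xss) = {}"
    using all_set_conv_all_nth[of xss "\<lambda>ys. set xs \<inter> set ys = {}"] by auto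
  show ?case
    unfolding 1 2 using Cons.IH by auto
qed

lemma labels_subtree: "t \<in> subtrees T \<Longrightarrow> set (labels t) \<subseteq> set (labels T)"
  by (induction T) auto

lemma dtree_Leaf [simp]: "dtree s Leaf"
  by (simp add: dtree_def)

lemma dtree_Node:
  "dtree s (Node y ts) \<longleftrightarrow> distinct (concat (map labels ts)) \<and> length ts = entry s y + 1 \<and>
     (\<forall>t\<in>set ts. dtree s t \<and> (\<forall>a\<in>set (labels t). a < y))"
  (is "?l \<longleftrightarrow> ?r")
proof
  assume l: ?l
  then have d: "distinct (concat (map labels ts))"
    by (simp add: dtree_def)
  have "dtree s t" if t: "t \<in> set ts" for t
  proof -
    have "distinct (labels t)"
      using d t by (simp add: distinct_concat_nth)
    moreover have "Node z us \<in> subtrees (Node y ts)" if "Node z us \<in> subtrees t" for z us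
      using that t by auto
    ultimately show ?thesis
      using l unfolding dtree_def by blast
  qed
  with d l show ?r
    unfolding dtree_def by auto
next
  assume r: ?r
  then have "y \<notin> set (concat (map labels ts))" by auto
  with r show ?l unfolding dtree_def by auto
qed

lemma label_child:
  "a \<in> set (labels (Node y ts)) \<Longrightarrow> a \<noteq> y \<Longrightarrow> \<exists>i<length ts. a \<in> set (labels (ts ! i))"
  by simp (metis in_set_conv_nth)

lemma dtree_disjoint:
  assumes "dtree s (Node y ts)" "i < length ts" "j < length ts"
    "a \<in> set (labels (ts ! i))" "a \<in> set (labels (ts ! j))"
  shows "i = j"
  using assms by (fastforce simp: dtree_Node distinct_concat_nth)

lemma dtree_same_child:
  assumes "dtree s (Node y ts)" "t \<in> set ts" "t' \<in> set ts" "a \<in> set (labels t)" "a \<in> set (labels t')"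
  shows "t = t'"
  using dtree_disjoint[OF assms(1)] assms(2-) by (metis in_set_conv_nth)

lemma dtree_cong:
  "(\<And>a. a \<in> set (labels T) \<Longrightarrow> entry s a = entry r a) \<Longrightarrow> dtree s T \<longleftrightarrow> dtree r T"
  by (induction T) (auto simp: dtree_Node)

section \<open>Ancestors and the left-to-right order\<close>

lemma is_child_Leaf [simp]: "\<not> is_child Leaf c i t"
  by (simp add: is_child_def)

lemma is_child_Node:
  "is_child (Node y ts) c i t \<longleftrightarrow>
     c = y \<and> i < length ts \<and> t = ts ! i \<or> (\<exists>t'\<in>set ts. is_child t' c i t)"
  unfolding is_child_def by auto

lemma in_child_Leaf [simp]: "\<not> in_child Leaf c i a"
  by (simp add: in_child_def)

lemma in_child_Node:
  "in_child (Node y ts) c i a \<longleftrightarrow>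
     c = y \<and> i < length ts \<and> a \<in> set (labels (ts ! i)) \<or> (\<exists>t\<in>set ts. in_child t c i a)"
  unfolding in_child_def is_child_Node by auto

lemma is_child_labels: "is_child T c i t \<Longrightarrow> c \<in> set (labels T)"
  unfolding is_child_def using labels_subtree by fastforce

lemma in_child_labels:
  "in_child T c i a \<Longrightarrow> c \<in> set (labels T) \<and> a \<in> set (labels T)"
proof (induction T)
  case (Node y ts)
  then show ?case by (fastforce simp: in_child_Node)
qed simp

lemma left_of_labels: "left_of T a c \<Longrightarrow> a \<in> set (labels T) \<and> c \<in> set (labels T)"
  unfolding left_of_def using in_child_labels by blast

lemma in_child_less: "dtree s T \<Longrightarrow> in_child T c i a \<Longrightarrow> a < c \<and> i \<le> entry s c"
proof (induction T)
  case (Node y ts)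
  then show ?case by (fastforce simp: in_child_Node dtree_Node)
qed simp

lemma is_child_unique:
  "dtree s T \<Longrightarrow> is_child T c i t \<Longrightarrow> is_child T c i t' \<Longrightarrow> t = t'"
proof (induction T)
  case (Node y ts)
  have y: "y \<notin> set (labels r)" if "r \<in> set ts" for r
    using Node.prems(1) that by (auto simp: dtree_Node)
  show ?case
  proof (cases "c = y")
    case True
    then show ?thesis using Node.prems y is_child_labels by (fastforce simp: is_child_Node)
  next
    case False
    then obtain r r' where r: "r \<in> set ts" "is_child r c i t" "r' \<in> set ts" "is_child r' c i t'"
      using Node.prems by (auto simp: is_child_Node)
    then have "r = r'"
      using is_child_labels[of r c i t] is_child_labels[of r' c i t'] dtree_same_child[OF Node.prems(1)]
      by blast
    with r Node.IH[of r] Node.prems(1) show ?thesis by (auto simp: dtree_Node)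
  qed
qed simp

lemma in_child_trans:
  "dtree s T \<Longrightarrow> in_child T c k b \<Longrightarrow> in_child T b i d \<Longrightarrow> in_child T c k d"
proof (induction T)
  case (Node y ts)
  have b_neq: "b \<noteq> y" using in_child_less[OF Node.prems(1,2)] in_child_labels[OF Node.prems(2)] Node.prems
    by (auto simp: dtree_Node in_child_Node dest: in_child_labels)
  then obtain r where r: "r \<in> set ts" "in_child r b i d"
    using Node.prems(3) by (auto simp: in_child_Node)
  from Node.prems(2) consider
    "c = y" "k < length ts" "b \<in> set (labels (ts ! k))" |
    q where "q \<in> set ts" "in_child q c k b" by (auto simp: in_child_Node)
  then show ?case
  proof cases
    case 1
    have "ts ! k = r"
      using r 1 in_child_labels[OF r(2)] dtree_same_child[OF Node.prems(1)] nth_mem by blast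
    with 1 r in_child_labels show ?thesis by (auto simp: in_child_Node)
  next
    case 2
    have "q = r"
      using r 2 in_child_labels[OF r(2)] in_child_labels[OF 2(2)] dtree_same_child[OF Node.prems(1)]
      by blast
    with 2 r Node.IH[of r] Node.prems(1) show ?thesis by (auto simp: in_child_Node dtree_Node)
  qed
qed simp

lemma in_child_unique:
  "dtree s T \<Longrightarrow> in_child T c i a \<Longrightarrow> in_child T c j a \<Longrightarrow> i = j"
proof (induction T)
  case (Node y ts)
  have y: "y \<notin> set (labels r)" if "r \<in> set ts" for r
    using Node.prems(1) that by (auto simp: dtree_Node)
  show ?case
  proof (cases "c = y")
    case True
    then have "\<not> in_child t c k a" if "t \<in> set ts" for t k
      using y that in_child_labels by blast
    with True show ?thesis using Node.prems dtree_disjoint[OF Node.prems(1)]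
      unfolding in_child_Node by blast
  next
    case False
    then obtain r r' where r: "r \<in> set ts" "in_child r c i a" "r' \<in> set ts" "in_child r' c j a"
      using Node.prems by (auto simp: in_child_Node)
    then have "r = r'"
      using in_child_labels[of r c i a] in_child_labels[of r' c j a] dtree_same_child[OF Node.prems(1)]
      by blast
    with r Node.IH[of r] Node.prems(1) show ?thesis by (auto simp: dtree_Node)
  qed
qed simp

lemma descendant_of_root:
  assumes "dtree s (Node x ts)" "in_child (Node x ts) x i c" "in_child (Node x ts) z k c"
  shows "z = x \<or> in_child (Node x ts) x i z"
proof -
  have x: "\<not> in_child t x m b" if "t \<in> set ts" for t m b
    using assms(1) that in_child_labels[of t x m b] by (auto simp: dtree_Node)
  then have i: "i < length ts" "c \<in> set (labels (ts ! i))"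
    using assms(2) unfolding in_child_Node by blast+
  consider "z = x" | t where "t \<in> set ts" "in_child t z k c"
    using assms(3) unfolding in_child_Node by blast
  then show ?thesis
  proof cases
    case 2
    then obtain j where j: "j < length ts" "t = ts ! j" by (metis in_set_conv_nth)
    have z: "z \<in> set (labels t)" "c \<in> set (labels t)" using 2 in_child_labels by blast+
    then have "j = i" using dtree_disjoint[OF assms(1)] i j by blast
    with z i j show ?thesis unfolding in_child_Node by blast
  qed simp
qed

lemma ancestors_comparable:
  "dtree s T \<Longrightarrow> in_child T y i c \<Longrightarrow> in_child T z k c \<Longrightarrow>
     y = z \<or> in_child T y i z \<or> in_child T z k y"
proof (induction T)
  case (Node x ts)
  consider "y = x" | "z = x" | "y \<noteq> x" "z \<noteq> x" by blast
  then show ?case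
  proof cases
    case 1
    with descendant_of_root Node.prems show ?thesis by blast
  next
    case 2
    with descendant_of_root Node.prems show ?thesis by blast
  next
    case 3
    then obtain r r' where r: "r \<in> set ts" "in_child r y i c" "r' \<in> set ts" "in_child r' z k c"
      using Node.prems unfolding in_child_Node by blast
    then have "r = r'"
      using in_child_labels[of r y i c] in_child_labels[of r' z k c] dtree_same_child[OF Node.prems(1)]
      by blast
    moreover have "dtree s r" using Node.prems(1) r by (simp add: dtree_Node)
    ultimately have "y = z \<or> in_child r y i z \<or> in_child r z k y"
      using r Node.IH by blast
    with r(1) show ?thesis unfolding in_child_Node by blast
  qed
qed simp

lemma left_of_subtree: "t \<in> set ts \<Longrightarrow> left_of t a c \<Longrightarrow> left_of (Node y ts) a c"
  unfolding left_of_def in_child_Node by blast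

lemma label_trichotomy:
  "dtree s T \<Longrightarrow> a \<in> set (labels T) \<Longrightarrow> c \<in> set (labels T) \<Longrightarrow> a < c \<Longrightarrow>
     left_of T a c \<or> left_of T c a \<or> (\<exists>i\<le>entry s c. in_child T c i a)"
proof (induction T)
  case (Node y ts)
  show ?case
  proof (cases "c = y")
    case True
    with Node.prems obtain i where "i < length ts" "a \<in> set (labels (ts ! i))"
      using label_child by blast
    with True Node.prems(1) show ?thesis by (auto simp: in_child_Node dtree_Node)
  next
    case False
    with Node.prems obtain i where i: "i < length ts" "c \<in> set (labels (ts ! i))"
      using label_child by blast
    then have "c < y" using Node.prems by (auto simp: dtree_Node)
    with Node.prems obtain j where j: "j < length ts" "a \<in> set (labels (ts ! j))"
      using label_child by (metis less_asym)
    show ?thesis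
    proof (cases "i = j")
      case True
      with i j Node.IH[of "ts ! i"] Node.prems have "left_of (ts!i) a c \<or> left_of (ts!i) c a \<or>
         (\<exists>k\<le>entry s c. in_child (ts!i) c k a)" by (auto simp: dtree_Node)
      with i left_of_subtree show ?thesis by (meson in_child_Node nth_mem)
    next
      case False
      with i j have "left_of (Node y ts) a c \<or> left_of (Node y ts) c a"
        unfolding left_of_def in_child_Node by (meson nat_neq_iff)
      then show ?thesis by blast
    qed
  qed
qed simp

lemma left_of_descendant:
  "dtree s T \<Longrightarrow> left_of T b c \<Longrightarrow> in_child T c j d \<Longrightarrow> left_of T b d"
  unfolding left_of_def using in_child_trans by blast

lemma left_of_descendant2:
  "dtree s T \<Longrightarrow> left_of T c b \<Longrightarrow> in_child T c j d \<Longrightarrow> left_of T d b"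
  unfolding left_of_def using in_child_trans by blast

lemma left_of_irrefl: "dtree s T \<Longrightarrow> \<not> left_of T a a"
  unfolding left_of_def using in_child_unique by blast

lemma left_of_trans:
  assumes "dtree s T" "left_of T b c" "left_of T c d"
  shows "left_of T b d"
proof -
  obtain y i j where y: "i < j" "in_child T y i b" "in_child T y j c"
    using assms(2) unfolding left_of_def by blast
  obtain z k l where z: "k < l" "in_child T z k c" "in_child T z l d"
    using assms(3) unfolding left_of_def by blast
  consider "y = z" | "in_child T y j z" | "in_child T z k y"
    using ancestors_comparable[OF assms(1) y(3) z(2)] by blast
  then show ?thesis
  proof cases
    case 1
    then have "j = k" using in_child_unique[OF assms(1)] y z by blast
    with 1 y z show ?thesis unfolding left_of_def by (meson less_trans)
  next
    case 2
    then show ?thesis using y z in_child_trans[OF assms(1)] unfolding left_of_def by blast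
  next
    case 3
    then show ?thesis using y z in_child_trans[OF assms(1)] unfolding left_of_def by blast
  qed
qed

lemma left_of_not_child:
  "dtree s T \<Longrightarrow> in_child T c i a \<Longrightarrow> \<not> left_of T a c \<and> \<not> left_of T c a"
  using left_of_descendant left_of_descendant2 left_of_irrefl by blast

section \<open>Tree-inversions determine the tree\<close>

lemma tree_inv_left:
  "left_of T a c \<Longrightarrow> tree_inv s T c a = 0"
  by (simp add: tree_inv_def)

lemma tree_inv_right:
  assumes "dtree s T" "left_of T c a" "1 \<le> a" "a < c" "c \<le> length s"
  shows "tree_inv s T c a = entry s c"
  using assms left_of_trans left_of_irrefl left_of_not_child unfolding tree_inv_def by meson

lemma tree_inv_child:
  assumes "dtree s T" "in_child T c i a" "1 \<le> a" "c \<le> length s"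
  shows "tree_inv s T c a = i"
proof -
  have "a < c" using in_child_less assms by blast
  moreover have "(THE i. in_child T c i a) = i"
    using assms in_child_unique by blast
  moreover have "in_child T c j a \<longleftrightarrow> j = i" for j
    using assms in_child_unique by blast
  ultimately show ?thesis
    using assms left_of_not_child[OF assms(1,2)] by (simp add: tree_inv_def)
qed

lemma tree_inv_le:
  assumes "dtree s T" "set (labels T) = {1..length s}"
  shows "tree_inv s T c a \<le> entry s c"
proof (cases "1 \<le> a \<and> a < c \<and> c \<le> length s")
  case True
  then have "left_of T a c \<or> left_of T c a \<or> (\<exists>i\<le>entry s c. in_child T c i a)"
    using assms by (intro label_trichotomy) auto
  with True show ?thesis
    using tree_inv_left tree_inv_right[OF assms(1)] tree_inv_child[OF assms(1)] by (metis le0 order_refl)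
next
  case False
  then show ?thesis unfolding tree_inv_def by auto
qed

lemma tree_inv_subtree:
  assumes "dtree s (Node y ts)" "i < length ts" "a \<in> set (labels (ts ! i))" "c \<in> set (labels (ts ! i))"
    "1 \<le> a" "a < c" "c \<le> length s"
  shows "tree_inv s (Node y ts) c a = tree_inv s (ts ! i) c a"
proof -
  have d: "dtree s (ts ! i)" using assms by (auto simp: dtree_Node)
  then consider "left_of (ts!i) a c" | "left_of (ts!i) c a" | k where "in_child (ts!i) c k a"
    using label_trichotomy[OF d assms(3,4)] assms by blast
  then show ?thesis
  proof cases
    case 1
    then show ?thesis using assms(2) left_of_subtree by (metis nth_mem tree_inv_left)
  next
    case 2
    then show ?thesis using tree_inv_right d assms left_of_subtree by (metis nth_mem)
  next
    case 3
    then have "in_child (Node y ts) c k a" using assms(2) by (auto simp: in_child_Node)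
    with 3 tree_inv_child d assms show ?thesis by metis
  qed
qed

lemma tree_inv_root:
  assumes "dtree s (Node y ts)" "i < length ts" "a \<in> set (labels (ts ! i))" "1 \<le> a" "y \<le> length s"
  shows "tree_inv s (Node y ts) y a = i"
  using assms by (intro tree_inv_child) (auto simp: in_child_Node)

lemma label_le_root: "dtree s (Node y ts) \<Longrightarrow> a \<in> set (labels (Node y ts)) \<Longrightarrow> a \<le> y"
  by (auto simp: dtree_Node intro: less_imp_le)

text \<open>
  The labels in the child \<open>i\<close> of the root \<open>y\<close> are those \<open>a\<close> for which the pair \<open>(y, a)\<close> has
  inversion number \<open>i\<close>.
\<close>

lemma tree_inv_inj:
  assumes "dtree s T" "dtree s T'" "set (labels T) = set (labels T')"
    "set (labels T) \<subseteq> {1..length s}"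
    "\<And>a c. a \<in> set (labels T) \<Longrightarrow> c \<in> set (labels T) \<Longrightarrow> a < c \<Longrightarrow>
       tree_inv s T c a = tree_inv s T' c a"
  shows "T = T'"
  using assms
proof (induction T arbitrary: T')
  case Leaf
  then show ?case by (cases T') auto
next
  case (Node y ts)
  then obtain y' ts' where T': "T' = Node y' ts'" by (cases T') auto
  have le: "\<And>a. a \<in> set (labels (Node y ts)) \<Longrightarrow> a \<le> y"
    "\<And>a. a \<in> set (labels T') \<Longrightarrow> a \<le> y'"
    using Node.prems(1,2) label_le_root unfolding T' by blast+
  have yy: "y' = y"
  proof (rule antisym)
    show "y' \<le> y" by (rule le(1)) (simp only: Node.prems(3) T', simp)
    show "y \<le> y'" by (rule le(2)) (simp only: Node.prems(3)[symmetric], simp)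
  qed
  have len: "length ts' = length ts"
    using Node.prems(1,2) unfolding T' yy by (simp add: dtree_Node)
  have range: "1 \<le> a" "a \<le> length s" if "a \<in> set (labels (Node y ts))" for a
    using Node.prems(4) that by (meson atLeastAtMost_iff subsetD)+
  have ym: "y \<in> set (labels (Node y ts))" by simp
  have root: "a \<in> set (labels (rs ! i)) \<longleftrightarrow>
      a \<in> set (labels (Node y rs)) \<and> a \<noteq> y \<and> tree_inv s (Node y rs) y a = i"
    if "dtree s (Node y rs)" "set (labels (Node y rs)) = set (labels (Node y ts))" "i < length rs" for rs i a
  proof
    assume a: "a \<in> set (labels (rs ! i))"
    then have "a \<in> set (labels (Node y rs))" using that by auto
    moreover from this have "1 \<le> a" "y \<le> length s" using range ym that(2) by blast+
    then have "tree_inv s (Node y rs) y a = i"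
      using tree_inv_root that(1,3) a by blast
    moreover have "a < y" using that a by (auto simp: dtree_Node)
    ultimately show "a \<in> set (labels (Node y rs)) \<and> a \<noteq> y \<and> tree_inv s (Node y rs) y a = i"
      by blast
  next
    assume a: "a \<in> set (labels (Node y rs)) \<and> a \<noteq> y \<and> tree_inv s (Node y rs) y a = i"
    then obtain j where j: "j < length rs" "a \<in> set (labels (rs ! j))" using label_child by blast
    have "1 \<le> a" "y \<le> length s" using a range ym that(2) by blast+
    with j a that tree_inv_root show "a \<in> set (labels (rs ! i))" by metis
  qed
  have "ts ! i = ts' ! i" if i: "i < length ts" for i
  proof (rule Node.IH)
    show "ts ! i \<in> set ts" using i by simp
    show "dtree s (ts ! i)" "dtree s (ts' ! i)"
      using Node.prems(1,2) i len unfolding T' yy by (auto simp: dtree_Node)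
    have sub: "set (labels (ts ! i)) \<subseteq> set (labels (Node y ts))" using i by auto
    with Node.prems(4) show "set (labels (ts ! i)) \<subseteq> {1..length s}" by blast
    have y_inv: "tree_inv s (Node y ts) y a = tree_inv s (Node y ts') y a"
      if "a \<in> set (labels (Node y ts))" "a \<noteq> y" for a
      using Node.prems(5)[OF that(1) ym] le(1)[OF that(1)] that(2) unfolding T' yy by simp
    have ts': "dtree s (Node y ts')" "set (labels (Node y ts')) = set (labels (Node y ts))"
      "i < length ts'"
      using Node.prems(2,3) i len unfolding T' yy by simp_all
    have "a \<in> set (labels (ts ! i)) \<longleftrightarrow> a \<in> set (labels (ts' ! i))" for a
      unfolding root[OF Node.prems(1) refl i] root[OF ts'] ts'(2) using y_inv by metis
    then show eq: "set (labels (ts ! i)) = set (labels (ts' ! i))" by blast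
    fix a c assume ac: "a \<in> set (labels (ts ! i))" "c \<in> set (labels (ts ! i))" "a < c"
    then have "1 \<le> a" "c \<le> length s" using sub range by blast+
    moreover have "tree_inv s (Node y ts) c a = tree_inv s (Node y ts') c a"
      using Node.prems(5)[of a c] ac sub unfolding T' yy by blast
    ultimately show "tree_inv s (ts ! i) c a = tree_inv s (ts' ! i) c a"
      using tree_inv_subtree[of s y ts i a c] tree_inv_subtree[of s y ts' i a c] Node.prems(1,2) i len ac eq
      unfolding T' yy by metis
  qed
  then have "ts = ts'" using len by (intro nth_equalityI) auto
  then show ?case using T' yy by simp
qed

text \<open>
  The last two hypotheses are transitivity and planarity of \<open>I\<close>. They are what is needed for
  pairs \<open>(c, a)\<close> lying in different children of the root: if \<open>a\<close> is in a child to the left of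
  \<open>c\<close> then transitivity gives \<open>I c a = 0\<close>, and if it is in a child to the right then planarity
  gives \<open>I c a = s(c)\<close>.
\<close>

lemma tree_inv_realise:
  assumes "finite X" "X \<subseteq> {1..length s}"
    "\<And>a c. a \<in> X \<Longrightarrow> c \<in> X \<Longrightarrow> a < c \<Longrightarrow> I c a \<le> entry s c"
    "\<And>a b c. a \<in> X \<Longrightarrow> b \<in> X \<Longrightarrow> c \<in> X \<Longrightarrow> a < b \<Longrightarrow> b < c \<Longrightarrow> I b a = 0 \<or> I c b \<le> I c a"
    "\<And>a b c. a \<in> X \<Longrightarrow> b \<in> X \<Longrightarrow> c \<in> X \<Longrightarrow> a < b \<Longrightarrow> b < c \<Longrightarrow> I b a = entry s b \<or> I c a \<le> I c b"
  shows "\<exists>T. dtree s T \<and> set (labels T) = X \<and>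
    (\<forall>a\<in>X. \<forall>c\<in>X. a < c \<longrightarrow> tree_inv s T c a = I c a)"
  using assms
proof (induction X rule: finite_psubset_induct)
  case (psubset X)
  show ?case
  proof (cases "X = {}")
    case True
    then show ?thesis by (intro exI[of _ Leaf]) auto
  next
    case False
    define y where "y = Max X"
    have y: "y \<in> X" "\<And>a. a \<in> X \<Longrightarrow> a \<le> y"
      using False psubset.hyps unfolding y_def by auto
    define Y where "Y i = {a \<in> X. a < y \<and> I y a = i}" for i
    have Ysub: "Y i \<subset> X" for i using y by (auto simp: Y_def)
    have "\<exists>T. dtree s T \<and> set (labels T) = Y i \<and>
      (\<forall>a\<in>Y i. \<forall>c\<in>Y i. a < c \<longrightarrow> tree_inv s T c a = I c a)" for i
    proof (rule psubset.IH[OF Ysub])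
      have X: "a \<in> X" if "a \<in> Y i" for a using that by (simp add: Y_def)
      show "Y i \<subseteq> {1..length s}" using X psubset.prems(1) by blast
      show "I c a \<le> entry s c" if "a \<in> Y i" "c \<in> Y i" "a < c" for a c
        using psubset.prems(2)[OF X X] that by blast
      show "I b a = 0 \<or> I c b \<le> I c a"
        if "a \<in> Y i" "b \<in> Y i" "c \<in> Y i" "a < b" "b < c" for a b c
        using psubset.prems(3)[OF X X X] that by blast
      show "I b a = entry s b \<or> I c a \<le> I c b"
        if "a \<in> Y i" "b \<in> Y i" "c \<in> Y i" "a < b" "b < c" for a b c
        using psubset.prems(4)[OF X X X] that by blast
    qed
    then obtain f where f: "\<And>i. dtree s (f i)" "\<And>i. set (labels (f i)) = Y i"
       "\<And>i a c. a \<in> Y i \<Longrightarrow> c \<in> Y i \<Longrightarrow> a < c \<Longrightarrow> tree_inv s (f i) c a = I c a"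
      by metis
    define ts where "ts = map f [0..<entry s y + 1]"
    have len: "length ts = entry s y + 1" by (simp add: ts_def)
    have nth: "ts ! i = f i" if "i < length ts" for i using that unfolding ts_def
      by (simp del: upt_Suc add: nth_map_upt)
    have d: "dtree s (Node y ts)"
      unfolding dtree_Node
    proof (intro conjI ballI)
      show "distinct (concat (map labels ts))"
        unfolding distinct_concat_nth
      proof (intro conjI ballI allI impI)
        fix xs assume "xs \<in> set (map labels ts)"
        then show "distinct xs" using f(1) by (auto simp: ts_def dtree_def)
      next
        fix i j assume "i < length (map labels ts)" "j < length (map labels ts)" "i \<noteq> j"
        then show "set (map labels ts ! i) \<inter> set (map labels ts ! j) = {}"
          using f(2) nth by (auto simp: Y_def)
      qed
      show "length ts = entry s y + 1" by (rule len)
    next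
      fix t a assume "t \<in> set ts" "a \<in> set (labels t)"
      then show "a < y" using f(2) by (auto simp: ts_def Y_def)
    next
      fix t assume "t \<in> set ts"
      then show "dtree s t" using f(1) by (auto simp: ts_def)
    qed
    have ex: "a = y \<or> (\<exists>i<length ts. a \<in> Y i)" if "a \<in> X" for a
      using that y psubset.prems(2)[of a y] len unfolding Y_def
      by (metis (mono_tags, lifting) le_neq_implies_less less_Suc_eq_le mem_Collect_eq Suc_eq_plus1)
    have lab: "set (labels (Node y ts)) = X"
    proof
      show "set (labels (Node y ts)) \<subseteq> X" using y f(2) by (auto simp: ts_def Y_def)
      show "X \<subseteq> set (labels (Node y ts))"
      proof
        fix a assume "a \<in> X"
        then consider "a = y" | i where "i < length ts" "a \<in> Y i" using ex by blast
        then show "a \<in> set (labels (Node y ts))"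
        proof cases
          case 2
          have "ts ! i \<in> set ts" using 2(1) by simp
          moreover have "a \<in> set (labels (ts ! i))" using 2 f(2) nth by simp
          ultimately show ?thesis by auto
        qed simp
      qed
    qed
    moreover have "tree_inv s (Node y ts) c a = I c a" if ac: "a \<in> X" "c \<in> X" "a < c" for a c
    proof -
      have r: "1 \<le> a" "c \<le> length s" "y \<le> length s" using ac y psubset.prems(1) by auto
      have "a \<noteq> y" using ac y(2)[of c] by auto
      then obtain i where i: "i < length ts" "a \<in> Y i" using ex ac by blast
      show ?thesis
      proof (cases "c = y")
        case True
        then show ?thesis using tree_inv_root[OF d i(1)] i f(2) nth r by (auto simp: Y_def)
      next
        case False
        then obtain j where j: "j < length ts" "c \<in> Y j" using ex ac by blast
        have L: "in_child (Node y ts) y i a" "in_child (Node y ts) y j c"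
          using i j f(2) nth by (auto simp: in_child_Node)
        consider "i = j" | "i < j" | "j < i" by linarith
        then show ?thesis
        proof cases
          case 1
          then show ?thesis using tree_inv_subtree[OF d i(1)] i j f(2,3) nth r ac by auto
        next
          case 2
          then have "left_of (Node y ts) a c" using L unfolding left_of_def by blast
          then have "tree_inv s (Node y ts) c a = 0" by (rule tree_inv_left)
          moreover have "I c a = 0"
            using psubset.prems(3)[of a c y] ac y i j 2 by (auto simp: Y_def)
          ultimately show ?thesis by simp
        next
          case 3
          then have "left_of (Node y ts) c a" using L unfolding left_of_def by blast
          then have "tree_inv s (Node y ts) c a = entry s c" using tree_inv_right[OF d] r ac by blast
          moreover have "I c a = entry s c"
            using psubset.prems(4)[of a c y] ac y i j 3 by (auto simp: Y_def)
          ultimately show ?thesis by simp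
        qed
      qed
    qed
    ultimately show ?thesis using d by blast
  qed
qed

section \<open>Transitive closures\<close>

lemma transitivity_path_Cons:
  "transitivity_path I c a (x # y # r) \<longleftrightarrow>
     x = c \<and> y < x \<and> 0 < I x y \<and> (r = [] \<and> y = a \<or> transitivity_path I y a (y # r))"
proof -
  have "(\<forall>i. i + 1 < length (x # y # r) \<longrightarrow>
          (x # y # r) ! i > (x # y # r) ! (i + 1) \<and> I ((x # y # r) ! i) ((x # y # r) ! (i + 1)) > 0) \<longleftrightarrow>
        y < x \<and> 0 < I x y \<and> (\<forall>i. i + 1 < length (y # r) \<longrightarrow>
          (y # r) ! i > (y # r) ! (i + 1) \<and> I ((y # r) ! i) ((y # r) ! (i + 1)) > 0)"
    (is "?l \<longleftrightarrow> ?r")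
  proof
    assume l: ?l
    from l[rule_format, of 0] l[rule_format, of "Suc i" for i] show ?r by simp
  next
    assume ?r
    then show ?l by (auto simp: nth_Cons split: nat.split)
  qed
  then show ?thesis
    unfolding transitivity_path_def by (cases r) auto
qed

lemma transitivity_pathE:
  assumes "transitivity_path I c a b"
  obtains d r where "b = c # d # r" "d < c" "0 < I c d" "d = a \<or> transitivity_path I d a (d # r)"
proof (cases b rule: remdups_adj.cases)
  case (3 x y r)
  then show ?thesis using assms that[of y r] unfolding 3 transitivity_path_Cons by blast
qed (use assms in \<open>simp_all add: transitivity_path_def\<close>)

lemma finite_path_values: "finite {I (b ! 0) (b ! 1) | b. transitivity_path I c a b}"
proof (rule finite_subset)
  have "I (b ! 0) (b ! 1) \<in> I c ` {..<c}" if "transitivity_path I c a b" for b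
    by (rule transitivity_pathE[OF that]) simp
  then show "{I (b ! 0) (b ! 1) | b. transitivity_path I c a b} \<subseteq> I c ` {..<c}"
    by blast
qed simp

lemma trans_closure_path:
  "transitivity_path I c a b \<Longrightarrow> I (b ! 0) (b ! 1) \<le> trans_closure I c a"
  unfolding trans_closure_def by (rule Max_ge) (use finite_path_values in auto)

lemma trans_closure_posE:
  assumes "0 < trans_closure I c a"
  obtains b where "transitivity_path I c a b" "trans_closure I c a = I (b ! 0) (b ! 1)"
proof -
  have "trans_closure I c a \<in> insert 0 {I (b ! 0) (b ! 1) | b. transitivity_path I c a b}"
    unfolding trans_closure_def by (rule Max_in) (use finite_path_values in auto)
  then show ?thesis using assms that by auto
qed

lemma trans_closure_first_step:
  assumes "0 < trans_closure I c a"
  obtains d where "d < c" "0 < I c d" "trans_closure I c a = I c d" "d = a \<or> 0 < trans_closure I d a"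
proof -
  obtain b where b: "transitivity_path I c a b" "trans_closure I c a = I (b ! 0) (b ! 1)"
    using assms by (rule trans_closure_posE)
  obtain d r where d: "b = c # d # r" "d < c" "0 < I c d"
     "d = a \<or> transitivity_path I d a (d # r)"
    using b(1) by (rule transitivity_pathE)
  have "0 < trans_closure I d a" if "d \<noteq> a"
  proof -
    have p: "transitivity_path I d a (d # r)" using d that by blast
    then obtain e q where "d # r = d # e # q" "0 < I d e" by (rule transitivity_pathE)
    with trans_closure_path[OF p] show ?thesis by simp
  qed
  with that d b(2) show ?thesis by auto
qed

lemma trans_closure_ge: "a < c \<Longrightarrow> I c a \<le> trans_closure I c a"
proof (cases "I c a = 0")
  case False
  assume "a < c"
  with False have "transitivity_path I c a [c, a]" by (simp add: transitivity_path_Cons)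
  from trans_closure_path[OF this] show ?thesis by simp
qed simp

lemma trans_closure_step:
  assumes "d < c" "0 < I c d" "0 < trans_closure I d a"
  shows "I c d \<le> trans_closure I c a"
proof -
  obtain b where b: "transitivity_path I d a b"
    using assms(3) by (rule trans_closure_posE)
  then obtain e r where r: "b = d # e # r" by (rule transitivity_pathE)
  have "transitivity_path I c a (c # b)"
    using b assms unfolding r by (simp add: transitivity_path_Cons[of I c a c])
  from trans_closure_path[OF this] r show ?thesis by simp
qed

lemma trans_closure_reach:
  assumes "d < c" "d = a \<or> 0 < trans_closure I d a"
  shows "I c d \<le> trans_closure I c a"
proof (cases "I c d = 0 \<or> d = a")
  case True
  then show ?thesis using trans_closure_ge[of d c I] assms(1) by auto
next
  case False
  then show ?thesis using trans_closure_step[of d c I a] assms by auto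
qed

lemma trans_closure_trans:
  "0 < trans_closure I c b \<Longrightarrow> 0 < trans_closure I b a \<Longrightarrow> trans_closure I c b \<le> trans_closure I c a"
proof (induction c rule: less_induct)
  case (less c)
  obtain d where d: "d < c" "0 < I c d" "trans_closure I c b = I c d" "d = b \<or> 0 < trans_closure I d b"
    using less.prems(1) by (rule trans_closure_first_step)
  have "0 < trans_closure I d a"
    using d(4) less.IH[OF d(1)] less.prems by (auto intro: less_le_trans)
  with d trans_closure_step[of d c I a] show ?case by simp
qed

section \<open>The weak order and tree-ascents\<close>

lemma weak_le_antisym:
  assumes "decreasing_tree s R" "decreasing_tree s T" "weak_le s R T" "weak_le s T R"
  shows "R = T"
proof (rule tree_inv_inj)
  show "dtree s R" "dtree s T" "set (labels R) = set (labels T)" "set (labels R) \<subseteq> {1..length s}"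
    using assms by (simp_all add: decreasing_tree_iff)
  fix a c assume "a \<in> set (labels R)" "c \<in> set (labels R)" "a < c"
  then show "tree_inv s R c a = tree_inv s T c a"
    using assms by (intro antisym) (simp_all add: weak_le_def decreasing_tree_iff)
qed

lemma ascent_child:
  assumes "decreasing_tree s T" "(a, c) \<in> tree_ascents s T"
  obtains i where "i < entry s c" "in_child T c i a" "tree_inv s T c a = i"
proof -
  have T: "dtree s T" using assms(1) by (simp add: decreasing_tree_iff)
  obtain i where i: "in_child T c i a" and *: "\<not> in_child T c (entry s c) a" "1 \<le> a" "c \<le> length s"
    using assms(2) by (auto simp: tree_ascents_def descendant_def)
  then have "i \<noteq> entry s c" by blast
  with i in_child_less[OF T i] tree_inv_child[OF T i] * that show ?thesis by simp
qed

lemma ascent_below: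
  assumes "(a, c) \<in> tree_ascents s T" "in_child T b k a" "a < b" "b < c"
  shows "in_child T b (entry s b) a"
proof -
  have "\<forall>b. c > b \<and> b > a \<and> descendant T a b \<longrightarrow> in_child T b (entry s b) a"
    using assms(1) unfolding tree_ascents_def by blast
  then show ?thesis using assms(2-4) unfolding descendant_def by blast
qed

text \<open>
  If \<open>(d, c)\<close> is a tree-ascent then \<open>d\<close> lies on the right spine of the child of \<open>c\<close> that
  contains it, so nothing in this child is to the right of \<open>d\<close>.
\<close>

lemma ascent_spine:
  assumes "decreasing_tree s T" "(d, c) \<in> tree_ascents s T" "in_child T c i d" "in_child T c i b"
  shows "\<not> left_of T d b"
proof
  have T: "dtree s T" using assms(1) by (simp add: decreasing_tree_iff)
  assume "left_of T d b"
  then obtain y k l where y: "k < l" "in_child T y k d" "in_child T y l b"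
    unfolding left_of_def by blast
  consider "c = y" | "in_child T c i y" | "in_child T y k c"
    using ancestors_comparable[OF T assms(3) y(2)] by blast
  then show False
  proof cases
    case 1
    then show False using in_child_unique[OF T] assms(3,4) y by blast
  next
    case 2
    then have "in_child T y (entry s y) d"
      using ascent_below[OF assms(2) y(2)] in_child_less[OF T] y(2) by blast
    then have "k = entry s y" using in_child_unique[OF T] y(2) by blast
    then show False using in_child_less[OF T y(3)] y(1) by simp
  next
    case 3
    then have "in_child T y k b" using in_child_trans[OF T] assms(4) by blast
    then show False using in_child_unique[OF T] y by blast
  qed
qed

lemma tree_inv_less_imp_left:
  assumes "decreasing_tree s T" "1 \<le> b" "b < c" "1 \<le> d" "d < c" "c \<le> length s"
    "tree_inv s T c b < tree_inv s T c d"
  shows "left_of T b d"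
proof -
  have T: "dtree s T" using assms(1) by (simp add: decreasing_tree_iff)
  have lab: "x \<in> set (labels T)" if "1 \<le> x" "x \<le> c" for x
    using that assms(1,6) by (simp add: decreasing_tree_iff)
  have b: "left_of T b c \<or> left_of T c b \<or> (\<exists>i\<le>entry s c. in_child T c i b)"
    and d: "left_of T d c \<or> left_of T c d \<or> (\<exists>i\<le>entry s c. in_child T c i d)"
    using assms label_trichotomy[OF T lab lab] by simp_all
  have inv: "left_of T c x \<Longrightarrow> tree_inv s T c x = entry s c" "in_child T c i x \<Longrightarrow> tree_inv s T c x = i"
    if "1 \<le> x" "x < c" for x i
    using that assms tree_inv_right[OF T] tree_inv_child[OF T] by auto
  have nd: "\<not> left_of T d c" using assms(7) tree_inv_left by force
  have nb: "\<not> left_of T c b"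
    using inv(1)[OF assms(2,3)] assms(7) tree_inv_le[OF T, of c d] assms(1)
    by (auto simp: decreasing_tree_iff)
  consider "left_of T b c" | i where "in_child T c i b" using b nb by blast
  then show ?thesis
  proof cases
    case 1
    then show ?thesis using d nd left_of_trans[OF T 1] left_of_descendant[OF T 1] by blast
  next
    case 2
    consider "left_of T c d" | j where "in_child T c j d" using d nd by blast
    then show ?thesis
    proof cases
      case 1
      then show ?thesis using left_of_descendant2[OF T _ 2] by blast
    next
      case j: 2
      then have "i < j" using inv(2)[OF assms(2,3) 2] inv(2)[OF assms(4,5) j] assms(7) by simp
      with 2 j show ?thesis unfolding left_of_def by blast
    qed
  qed
qed

section \<open>Existence of the tree obtained by adding tree-ascents\<close>

text \<open>
  The data of a pure interval: an \<open>s\<close>-decreasing tree and a set of tree-ascents of it.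
\<close>

locale ascent_set =
  fixes s :: "nat list" and T :: ltree and A :: "(nat \<times> nat) set"
  assumes decreasing: "decreasing_tree s T"
    and ascents: "A \<subseteq> tree_ascents s T"
begin

text \<open>
  The inversion numbers of \<open>T\<close> raised by one on the pairs from \<open>A\<close>, and their transitive
  closure. Write \<open>I\<close> for the former and \<open>J\<close> for the latter.
\<close>

definition raised_inv :: pair_mset where
  "raised_inv c a = tree_inv s T c a + (if (a, c) \<in> A then 1 else 0)"

abbreviation closed_inv :: pair_mset where
  "closed_inv \<equiv> trans_closure raised_inv"

lemma dtree_T: "dtree s T"
  using decreasing by (simp add: decreasing_tree_iff)

lemma labels_T: "set (labels T) = {1..length s}"
  using decreasing by (simp add: decreasing_tree_iff)

lemma raised_inv_pos:
  assumes "0 < raised_inv c e"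
  shows "1 \<le> e" "e < c" "c \<le> length s" "left_of T c e \<or> (\<exists>i. in_child T c i e)"
proof -
  have "1 \<le> e \<and> e < c \<and> c \<le> length s \<and> (left_of T c e \<or> (\<exists>i. in_child T c i e))"
  proof (cases "(e, c) \<in> A")
    case True
    then show ?thesis using ascents by (auto simp: tree_ascents_def descendant_def)
  next
    case False
    then have p: "0 < tree_inv s T c e" using assms by (simp add: raised_inv_def)
    then have r: "1 \<le> e \<and> e < c \<and> c \<le> length s" by (auto simp: tree_inv_def split: if_splits)
    with p label_trichotomy[OF dtree_T, of e c] tree_inv_left[of T e c s] show ?thesis
      by (auto simp: labels_T)
  qed
  then show "1 \<le> e" "e < c" "c \<le> length s" "left_of T c e \<or> (\<exists>i. in_child T c i e)" by blast+
qed

lemma raised_inv_le: "raised_inv c a \<le> entry s c"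
proof (cases "(a, c) \<in> A")
  case True
  then obtain i where "i < entry s c" "tree_inv s T c a = i"
    using ascent_child[OF decreasing] ascents by (metis subsetD)
  then show ?thesis by (simp add: raised_inv_def)
next
  case False
  then show ?thesis using tree_inv_le[OF dtree_T labels_T] by (simp add: raised_inv_def)
qed

lemma closed_inv_le: "closed_inv c a \<le> entry s c"
proof (cases "0 < closed_inv c a")
  case True
  then show ?thesis using raised_inv_le by (metis trans_closure_first_step)
qed simp

lemma closed_inv_pos: "0 < closed_inv c a \<Longrightarrow> 1 \<le> a \<and> a < c \<and> c \<le> length s"
proof (induction c rule: less_induct)
  case (less c)
  obtain d where d: "d < c" "0 < raised_inv c d" "d = a \<or> 0 < closed_inv d a"
    using less.prems by (rule trans_closure_first_step)
  then show ?case using less.IH[OF d(1)] raised_inv_pos[OF d(2)] by auto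
qed

text \<open>
  A step of a transitivity path leads to a descendant or to the right. So a path that is to
  the right of a node \<open>b\<close> remains to the right of \<open>b\<close>; in particular it never reaches \<open>b\<close>.
\<close>

lemma left_of_step:
  "left_of T b d \<Longrightarrow> 0 < raised_inv d e \<Longrightarrow> left_of T b e"
  using raised_inv_pos(4) left_of_trans[OF dtree_T] left_of_descendant[OF dtree_T] by blast

lemma closed_inv_left: "left_of T b d \<Longrightarrow> closed_inv d b = 0"
proof (induction d rule: less_induct)
  case (less d)
  show ?case
  proof (rule ccontr)
    assume "closed_inv d b \<noteq> 0"
    then obtain e where e: "e < d" "0 < raised_inv d e" "e = b \<or> 0 < closed_inv e b"
      by (metis trans_closure_first_step neq0_conv)
    then have "left_of T b e" using left_of_step less.prems by blast
    with e less.IH[OF e(1)] left_of_irrefl[OF dtree_T, of b] show False by auto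
  qed
qed

text \<open>
  The first node smaller than \<open>b\<close> on a path from \<open>d\<close> to \<open>a\<close> is to the right of \<open>b\<close>, so that
  its pair with \<open>b\<close> has inversion number \<open>s(b)\<close>.
\<close>

lemma closed_inv_right:
  assumes "left_of T b d" "a < b" "1 \<le> a" "b \<le> length s" "d = a \<or> 0 < closed_inv d a"
  shows "closed_inv b a = entry s b"
proof -
  have "entry s b \<le> closed_inv b a"
    using assms(1,5)
  proof (induction d rule: less_induct)
    case (less d)
    have "b \<noteq> d" using less.prems left_of_irrefl[OF dtree_T] by blast
    then consider "d < b" | "b < d" by linarith
    then show ?case
    proof cases
      case 1
      have "1 \<le> d" using left_of_labels[OF less.prems(1)] labels_T by simp
      then have "entry s b \<le> raised_inv b d"
        using tree_inv_right[OF dtree_T less.prems(1)] 1 assms by (simp add: raised_inv_def)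
      moreover have "raised_inv b d \<le> closed_inv b a"
        using trans_closure_reach[OF 1 less.prems(2)] .
      ultimately show ?thesis by simp
    next
      case 2
      with less.prems assms have "0 < closed_inv d a" by auto
      then obtain e where e: "e < d" "0 < raised_inv d e" "e = a \<or> 0 < closed_inv e a"
        by (rule trans_closure_first_step)
      then show ?thesis using less.IH left_of_step less.prems by blast
    qed
  qed
  with closed_inv_le show ?thesis by (simp add: antisym)
qed

text \<open>
  Let \<open>J(c, a) > J(c, b)\<close>, and let \<open>d\<close> be the second node of a path from \<open>c\<close> to \<open>a\<close> that
  attains \<open>J(c, a) = I(c, d)\<close>. Either \<open>d\<close> is to the right of \<open>b\<close>, and \<open>closed_inv_right\<close>
  applies, or \<open>(d, c)\<close> is in \<open>A\<close> and \<open>b\<close> is in the same child of \<open>c\<close> as \<open>d\<close>. In the second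
  case \<open>d\<close> is on the right spine of this child. If \<open>d < b\<close> and \<open>d\<close> is not to the right of \<open>b\<close>,
  then \<open>d\<close> is in the right child of \<open>b\<close>, so that \<open>J(b, a) \<ge> I(b, d) \<ge> s(b)\<close>. If \<open>b < d\<close>, then
  \<open>J(d, b) = 0\<close>, since otherwise \<open>J(c, b) \<ge> I(c, d)\<close>; as \<open>J(d, a) > 0\<close>, the induction
  hypothesis for \<open>d\<close> in place of \<open>c\<close> gives the claim.
\<close>

lemma closed_inv_planar:
  "1 \<le> a \<Longrightarrow> a < b \<Longrightarrow> b < c \<Longrightarrow> c \<le> length s \<Longrightarrow>
     closed_inv b a = entry s b \<or> closed_inv c a \<le> closed_inv c b"
proof (induction c rule: less_induct)
  case (less c)
  show ?case
  proof (rule disjCI)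
    assume "\<not> closed_inv c a \<le> closed_inv c b"
    then have lt: "closed_inv c b < closed_inv c a" by simp
    then obtain d where d: "d < c" "0 < raised_inv c d" "closed_inv c a = raised_inv c d"
       "d = a \<or> 0 < closed_inv d a"
      by (metis trans_closure_first_step gr_implies_not0 neq0_conv)
    have lt': "raised_inv c b < raised_inv c d"
      using trans_closure_ge[of b c raised_inv] less.prems lt d by simp
    note rd = raised_inv_pos[OF d(2)]
    have db: "d \<noteq> b" using lt' by blast
    show "closed_inv b a = entry s b"
    proof (cases "tree_inv s T c b < tree_inv s T c d")
      case True
      then have "left_of T b d"
        using tree_inv_less_imp_left[OF decreasing] less.prems rd by simp
      then show ?thesis using closed_inv_right less.prems d by simp
    next
      case False
      with lt' have A: "(d, c) \<in> A" and eq: "tree_inv s T c b = tree_inv s T c d"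
        by (auto simp: raised_inv_def split: if_splits)
      obtain i where i: "i < entry s c" "in_child T c i d" "tree_inv s T c d = i"
        using ascent_child[OF decreasing] A ascents by blast
      have right: ?thesis if "left_of T b d"
        using closed_inv_right that less.prems d by simp
      consider "left_of T b c" | "left_of T c b" | j where "in_child T c j b"
        using label_trichotomy[OF dtree_T, of b c] less.prems by (auto simp: labels_T)
      then show ?thesis
      proof cases
        case 1
        then show ?thesis using right left_of_descendant[OF dtree_T] i(2) by blast
      next
        case 2
        then show ?thesis using tree_inv_right[OF dtree_T 2] less.prems i eq by simp
      next
        case 3
        then have j: "in_child T c i b"
          using tree_inv_child[OF dtree_T 3] less.prems i eq by simp
        then have nl: "\<not> left_of T d b"
          using ascent_spine[OF decreasing _ i(2)] A ascents by blast
        consider "d < b" | "b < d" using db by linarith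
        then show ?thesis
        proof cases
          case 1
          then consider "left_of T b d" | k where "in_child T b k d"
            using label_trichotomy[OF dtree_T, of d b] nl less.prems rd by (auto simp: labels_T)
          then show ?thesis
          proof cases
            case 2
            then have "in_child T b (entry s b) d"
              using ascent_below[OF _ 2 1 less.prems(3)] A ascents by blast
            then have e: "entry s b \<le> raised_inv b d"
              using tree_inv_child[OF dtree_T] less.prems rd by (simp add: raised_inv_def)
            have "raised_inv b d \<le> closed_inv b a"
              using trans_closure_reach[OF 1 d(4)] .
            with e closed_inv_le[of b a] show ?thesis by simp
          qed (rule right)
        next
          case 2
          with d less.prems have da: "0 < closed_inv d a" by auto
          then have "0 < entry s d" using closed_inv_le[of d a] by simp
          have "closed_inv d b = 0"
          proof (rule ccontr)
            assume "closed_inv d b \<noteq> 0"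
            then have "raised_inv c d \<le> closed_inv c b"
              using trans_closure_reach[OF d(1)] by blast
            with lt d show False by simp
          qed
          then show ?thesis
            using less.IH[OF d(1) less.prems(1,2) 2] da less.prems d by auto
        qed
      qed
    qed
  qed
qed

lemma tree_plus:
  "decreasing_tree s (tree_plus s T A)" "tree_inv s (tree_plus s T A) = closed_inv"
proof -
  have "\<exists>R. dtree s R \<and> set (labels R) = {1..length s} \<and>
    (\<forall>a\<in>{1..length s}. \<forall>c\<in>{1..length s}. a < c \<longrightarrow> tree_inv s R c a = closed_inv c a)"
  proof (rule tree_inv_realise)
    show "closed_inv c a \<le> entry s c" for c a by (rule closed_inv_le)
    show "closed_inv b a = 0 \<or> closed_inv c b \<le> closed_inv c a" for a b c
      using trans_closure_trans[of raised_inv c b a] by (cases "closed_inv c b = 0") auto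
    show "closed_inv b a = entry s b \<or> closed_inv c a \<le> closed_inv c b"
      if "a \<in> {1..length s}" "c \<in> {1..length s}" "a < b" "b < c" for a b c
      using closed_inv_planar that by simp
  qed simp_all
  then obtain R where R: "decreasing_tree s R"
    "\<And>a c. a \<in> {1..length s} \<Longrightarrow> c \<in> {1..length s} \<Longrightarrow> a < c \<Longrightarrow> tree_inv s R c a = closed_inv c a"
    unfolding decreasing_tree_iff by blast
  have inv: "tree_inv s R = closed_inv"
  proof (intro ext)
    fix c a
    show "tree_inv s R c a = closed_inv c a"
    proof (cases "1 \<le> a \<and> a < c \<and> c \<le> length s")
      case True
      then show ?thesis using R by simp
    next
      case False
      then have "closed_inv c a = 0" using closed_inv_pos by blast
      then show ?thesis using False by (auto simp: tree_inv_def)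
    qed
  qed
  have uniq: "R' = R" if "decreasing_tree s R'" "tree_inv s R' = closed_inv" for R'
    by (rule weak_le_antisym[OF that(1) R(1)]) (simp_all add: weak_le_def inv that(2))
  have eq: "(\<lambda>c a. tree_inv s T c a + (if (a, c) \<in> A then 1 else 0)) = raised_inv"
    by (intro ext) (simp add: raised_inv_def)
  have "tree_plus s T A = R"
    unfolding tree_plus_def eq
  proof (rule the_equality)
    show "decreasing_tree s R \<and> tree_inv s R = closed_inv" using R(1) inv by blast
    show "R' = R" if "decreasing_tree s R' \<and> tree_inv s R' = closed_inv" for R'
      using that uniq by blast
  qed
  with R(1) inv show "decreasing_tree s (tree_plus s T A)" "tree_inv s (tree_plus s T A) = closed_inv"
    by simp_all
qed

lemma weak_le_tree_plus: "weak_le s T (tree_plus s T A)"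
  unfolding weak_le_def tree_plus(2)
proof (intro allI impI)
  fix a c assume "1 \<le> a \<and> a < c \<and> c \<le> length s"
  then have "raised_inv c a \<le> closed_inv c a" using trans_closure_ge by blast
  then show "tree_inv s T c a \<le> closed_inv c a" by (simp add: raised_inv_def)
qed

text \<open>
  A path that increases the inversion number of a tree-ascent \<open>(a, c)\<close> not in \<open>A\<close> would have
  to start with a pair \<open>(d, c)\<close> in \<open>A\<close>, where both \<open>a\<close> and \<open>d\<close> are on the right spine of the
  same child of \<open>c\<close>, so that \<open>a\<close> is in the right child of \<open>d\<close>. This child is empty if
  \<open>s(d) > 0\<close>, and there is no step out of \<open>d\<close> if \<open>s(d) = 0\<close>.
\<close>

lemma closed_inv_other_ascent:
  assumes "(a, c) \<in> tree_ascents s T" "(a, c) \<notin> A"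
  shows "closed_inv c a \<le> tree_inv s T c a"
proof (rule ccontr)
  assume "\<not> ?thesis"
  then have lt: "tree_inv s T c a < closed_inv c a" by simp
  then obtain d where d: "d < c" "0 < raised_inv c d" "closed_inv c a = raised_inv c d"
     "d = a \<or> 0 < closed_inv d a"
    by (metis trans_closure_first_step gr_implies_not0 neq0_conv)
  note rd = raised_inv_pos[OF d(2)]
  have ac: "1 \<le> a" "a < c" "c \<le> length s" using assms(1) by (auto simp: tree_ascents_def)
  have da: "d \<noteq> a" using lt d assms(2) by (auto simp: raised_inv_def)
  with d have J: "0 < closed_inv d a" by blast
  with closed_inv_left have nl: "\<not> left_of T a d" by force
  then have "\<not> tree_inv s T c a < tree_inv s T c d"
    using tree_inv_less_imp_left[OF decreasing] ac rd by blast
  with lt d have A: "(d, c) \<in> A" and eq: "tree_inv s T c a = tree_inv s T c d"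
    by (auto simp: raised_inv_def split: if_splits)
  then have Asc: "(d, c) \<in> tree_ascents s T" using ascents by blast
  obtain i where i: "in_child T c i d" "tree_inv s T c d = i"
    using ascent_child[OF decreasing Asc] by blast
  obtain j where j: "in_child T c j a" "tree_inv s T c a = j"
    using ascent_child[OF decreasing assms(1)] by blast
  have ij: "in_child T c i a" using i j eq by simp
  have "\<not> left_of T d a" using ascent_spine[OF decreasing Asc i(1) ij] .
  moreover have ad: "a < d" using closed_inv_pos[OF J] by simp
  ultimately obtain k where k: "in_child T d k a"
    using nl label_trichotomy[OF dtree_T, of a d] ac d by (auto simp: labels_T)
  then have r: "in_child T d (entry s d) a"
    using ascent_below[OF assms(1) k ad d(1)] by simp
  have "0 < entry s d" using J closed_inv_le[of d a] by simp
  then have "is_child T d (entry s d) Leaf" using Asc by (auto simp: tree_ascents_def)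
  with r show False
    using is_child_unique[OF dtree_T] unfolding in_child_def by fastforce
qed

lemma ascent_recovery:
  assumes "(a, c) \<in> tree_ascents s T"
  shows "(a, c) \<in> A \<longleftrightarrow> tree_inv s T c a < tree_inv s (tree_plus s T A) c a"
proof
  assume "(a, c) \<in> A"
  moreover have "a < c" using assms by (auto simp: tree_ascents_def)
  ultimately show "tree_inv s T c a < tree_inv s (tree_plus s T A) c a"
    using trans_closure_ge[of a c raised_inv] by (simp add: tree_plus(2) raised_inv_def)
next
  assume "tree_inv s T c a < tree_inv s (tree_plus s T A) c a"
  then show "(a, c) \<in> A"
    using closed_inv_other_ascent[OF assms] by (auto simp: tree_plus(2))
qed

end

lemma pure_interval_inj:
  assumes "ascent_set s T A" "ascent_set s T' A'"
    "interval s T (tree_plus s T A) = interval s T' (tree_plus s T' A')"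
  shows "T = T' \<and> A = A'"
proof -
  interpret X: ascent_set s T A by fact
  interpret Y: ascent_set s T' A' by fact
  have refl: "weak_le s R R" for R by (simp add: weak_le_def)
  have "T \<in> interval s T (tree_plus s T A)" "tree_plus s T A \<in> interval s T (tree_plus s T A)"
    "T' \<in> interval s T' (tree_plus s T' A')" "tree_plus s T' A' \<in> interval s T' (tree_plus s T' A')"
    using X.decreasing Y.decreasing X.tree_plus(1) Y.tree_plus(1) X.weak_le_tree_plus Y.weak_le_tree_plus refl
    by (auto simp: interval_def)
  then have *: "T \<in> interval s T' (tree_plus s T' A')" "tree_plus s T A \<in> interval s T' (tree_plus s T' A')"
    "T' \<in> interval s T (tree_plus s T A)" "tree_plus s T' A' \<in> interval s T (tree_plus s T A)"
    using assms(3) by blast+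
  have T: "T = T'" using * weak_le_antisym by (auto simp: interval_def)
  have P: "tree_plus s T A = tree_plus s T' A'" using * weak_le_antisym by (auto simp: interval_def)
  have "x \<in> A \<longleftrightarrow> x \<in> A'" for x
  proof (cases "x \<in> tree_ascents s T")
    case True
    then show ?thesis using X.ascent_recovery[of "fst x" "snd x"] Y.ascent_recovery[of "fst x" "snd x"] T P
      by simp
  next
    case False
    then show ?thesis using X.ascents Y.ascents T by blast
  qed
  with T show ?thesis by blast
qed

section \<open>Counting tree-ascents by shape\<close>

text \<open>
  The number of nodes \<open>a\<close> of a tree such that \<open>a\<close> has a single child or its right child is a
  leaf, not counting the nodes on the right spine if the second argument is \<open>True\<close>. A tree
  with \<open>True\<close> stands for a whole tree or the end of its right spine, a tree with \<open>False\<close> for a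
  subtree off the spine. The list of children is never empty in the trees of interest.
\<close>

primrec ascent_count :: "ltree \<Rightarrow> bool \<Rightarrow> nat" where
  "ascent_count Leaf = (\<lambda>r. 0)"
| "ascent_count (Node y ts) = (\<lambda>r.
     (if \<not> r \<and> (length ts = 1 \<or> last ts = Leaf) then 1 else 0) +
     (\<Sum>f\<leftarrow>butlast (map ascent_count ts). f False) + last (map ascent_count ts) r)"

lemma ascent_count_Node:
  "ascent_count (Node y (ts @ [t])) r =
     (if \<not> r \<and> (ts = [] \<or> t = Leaf) then 1 else 0) +
     (\<Sum>t\<leftarrow>ts. ascent_count t False) + ascent_count t r"
  by (simp add: comp_def)

declare ascent_count.simps(2) [simp del]

text \<open>
  The node \<open>a\<close> is in the right child of each of its ancestors.
\<close>

definition on_spine :: "nat list \<Rightarrow> ltree \<Rightarrow> nat \<Rightarrow> bool" where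
  "on_spine s T a \<longleftrightarrow> (\<forall>b i. in_child T b i a \<longrightarrow> i = entry s b)"

text \<open>
  The nodes counted by \<open>ascent_count\<close>, in terms of labels; for \<open>r = True\<close> these are the lower
  ends of the tree-ascents.
\<close>

definition ascent_nodes :: "nat list \<Rightarrow> ltree \<Rightarrow> bool \<Rightarrow> nat set" where
  "ascent_nodes s T r = {a \<in> set (labels T). \<not> (r \<and> on_spine s T a) \<and>
     (0 < entry s a \<longrightarrow> is_child T a (entry s a) Leaf)}"

lemma ascent_nodes_child:
  assumes "dtree s (Node y ts)" "i < length ts"
  shows "ascent_nodes s (Node y ts) r \<inter> set (labels (ts ! i)) =
    ascent_nodes s (ts ! i) (r \<and> i = entry s y)"
proof -
  have "a \<in> ascent_nodes s (Node y ts) r \<longleftrightarrow> a \<in> ascent_nodes s (ts ! i) (r \<and> i = entry s y)"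
    if a: "a \<in> set (labels (ts ! i))" for a
  proof -
    have ti: "ts ! i \<in> set ts" using assms(2) by simp
    have "a \<noteq> y" using assms(1) a ti by (auto simp: dtree_Node)
    moreover have "is_child t a k l \<Longrightarrow> t \<in> set ts \<Longrightarrow> t = ts ! i" for t k l
      using is_child_labels dtree_same_child[OF assms(1) _ ti _ a] by blast
    ultimately have c: "is_child (Node y ts) a k l \<longleftrightarrow> is_child (ts ! i) a k l" for k l
      using ti unfolding is_child_Node by blast
    have t: "t = ts ! i" if "in_child t b k a" "t \<in> set ts" for t b k
      using that in_child_labels dtree_same_child[OF assms(1) _ ti _ a] by blast
    have "b = y \<and> k < length ts \<and> a \<in> set (labels (ts ! k)) \<longleftrightarrow> b = y \<and> k = i" for b k
      using dtree_disjoint[OF assms(1)] a assms(2) by blast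
    then have ic: "in_child (Node y ts) b k a \<longleftrightarrow> b = y \<and> k = i \<or> in_child (ts ! i) b k a" for b k
      using t ti unfolding in_child_Node by blast
    have "on_spine s (Node y ts) a \<longleftrightarrow> i = entry s y \<and> on_spine s (ts ! i) a"
      unfolding on_spine_def ic by auto
    with c a ti show ?thesis unfolding ascent_nodes_def by auto
  qed
  moreover have "ascent_nodes s (ts ! i) q \<subseteq> set (labels (ts ! i))" for q
    by (auto simp: ascent_nodes_def)
  ultimately show ?thesis by blast
qed

lemma card_ascent_nodes:
  "dtree s T \<Longrightarrow> card (ascent_nodes s T r) = ascent_count T r"
proof (induction T arbitrary: r)
  case Leaf
  then show ?case by (simp add: ascent_nodes_def)
next
  case (Node y ts)
  let ?N = "ascent_nodes s (Node y ts) r"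
  have len: "length ts = Suc (entry s y)" using Node.prems by (simp add: dtree_Node)
  then obtain us t where ts: "ts = us @ [t]" by (metis length_Suc_conv_rev)
  have us: "length us = entry s y" using len ts by simp
  have y: "y \<notin> set (labels t)" if "t \<in> set ts" for t
    using Node.prems that by (auto simp: dtree_Node)
  have spine: "on_spine s (Node y ts) y"
    using in_child_less[OF Node.prems] in_child_labels label_le_root[OF Node.prems]
    unfolding on_spine_def by (meson not_less)
  have right: "is_child (Node y ts) y (entry s y) t"
    using ts us by (simp add: is_child_Node nth_append)
  have root: "y \<in> ?N \<longleftrightarrow> \<not> r \<and> (us = [] \<or> t = Leaf)"
    using spine right us is_child_unique[OF Node.prems right, of Leaf]
    unfolding ascent_nodes_def by auto
  have "?N = (?N \<inter> {y}) \<union> (\<Union>i<length ts. ?N \<inter> set (labels (ts ! i)))"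
  proof -
    have "a = y \<or> (\<exists>i<length ts. a \<in> set (labels (ts ! i)))" if "a \<in> ?N" for a
      using that label_child unfolding ascent_nodes_def by blast
    then show ?thesis by blast
  qed
  also have "\<dots> = (?N \<inter> {y}) \<union> (\<Union>i<length ts. ascent_nodes s (ts ! i) (r \<and> i = entry s y))"
    using ascent_nodes_child[OF Node.prems] by auto
  also have "card \<dots> = card (?N \<inter> {y}) + card (\<Union>i<length ts. ascent_nodes s (ts ! i) (r \<and> i = entry s y))"
  proof (rule card_Un_disjoint)
    show "(?N \<inter> {y}) \<inter> (\<Union>i<length ts. ascent_nodes s (ts ! i) (r \<and> i = entry s y)) = {}"
      using y by (auto simp: ascent_nodes_def)
  qed (auto simp: ascent_nodes_def)
  also have "card (\<Union>i<length ts. ascent_nodes s (ts ! i) (r \<and> i = entry s y)) =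
      (\<Sum>i<length ts. card (ascent_nodes s (ts ! i) (r \<and> i = entry s y)))"
  proof (rule card_UN_disjoint)
    show "\<forall>i\<in>{..<length ts}. \<forall>j\<in>{..<length ts}. i \<noteq> j \<longrightarrow>
      ascent_nodes s (ts ! i) (r \<and> i = entry s y) \<inter> ascent_nodes s (ts ! j) (r \<and> j = entry s y) = {}"
      using dtree_disjoint[OF Node.prems] unfolding ascent_nodes_def by blast
  qed (auto simp: ascent_nodes_def)
  also have "\<dots> = (\<Sum>i<length ts. ascent_count (ts ! i) (r \<and> i = entry s y))"
  proof (rule sum.cong[OF refl])
    fix i assume "i \<in> {..<length ts}"
    then have "ts ! i \<in> set ts" by simp
    moreover from this have "dtree s (ts ! i)" using Node.prems by (simp add: dtree_Node)
    ultimately show "card (ascent_nodes s (ts ! i) (r \<and> i = entry s y)) =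
        ascent_count (ts ! i) (r \<and> i = entry s y)"
      by (rule Node.IH)
  qed
  also have "\<dots> = (\<Sum>i<length us. ascent_count (us ! i) False) + ascent_count t r"
    unfolding ts by (simp add: nth_append us)
  also have "(\<Sum>i<length us. ascent_count (us ! i) False) = (\<Sum>t\<leftarrow>us. ascent_count t False)"
    by (simp add: sum_list_sum_nth atLeast0LessThan)
  also have "card (?N \<inter> {y}) = (if \<not> r \<and> (us = [] \<or> t = Leaf) then 1 else 0)"
    using root by auto
  finally show ?case unfolding ts ascent_count_Node by simp
qed

text \<open>
  The upper end of a tree-ascent is the lowest ancestor that does not have the lower end in
  its right child, so it is determined by the lower end.
\<close>

lemma card_tree_ascents:
  assumes "decreasing_tree s T"
  shows "card (tree_ascents s T) = ascent_count T True"
proof -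
  have T: "dtree s T" and lab: "set (labels T) = {1..length s}"
    using assms by (simp_all add: decreasing_tree_iff)
  have not_right: "\<not> in_child T c (entry s c) a" if "(a, c) \<in> tree_ascents s T" for a c
    using that by (simp add: tree_ascents_def)
  have "inj_on fst (tree_ascents s T)"
  proof (rule inj_onI, clarsimp)
    fix a c c' assume a: "(a, c) \<in> tree_ascents s T" "(a, c') \<in> tree_ascents s T"
    obtain i j where ij: "in_child T c i a" "in_child T c' j a"
      using ascent_child[OF assms a(1)] ascent_child[OF assms a(2)] by metis
    have less: "a < c" "a < c'" using in_child_less[OF T] ij by blast+
    show "c = c'"
      using ascent_below[OF a(1) ij(2) less(2)] ascent_below[OF a(2) ij(1) less(1)]
        not_right[OF a(1)] not_right[OF a(2)] by (meson nat_neq_iff)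
  qed
  moreover have "fst ` tree_ascents s T = ascent_nodes s T True"
  proof
    show "fst ` tree_ascents s T \<subseteq> ascent_nodes s T True"
    proof clarsimp
      fix a c assume a: "(a, c) \<in> tree_ascents s T"
      obtain i where "in_child T c i a" "i < entry s c" using ascent_child[OF assms a] by metis
      then have "\<not> on_spine s T a" "a \<in> set (labels T)"
        using in_child_labels by (auto simp: on_spine_def)
      with a show "a \<in> ascent_nodes s T True" by (simp add: ascent_nodes_def tree_ascents_def)
    qed
    show "ascent_nodes s T True \<subseteq> fst ` tree_ascents s T"
    proof
      fix a assume a: "a \<in> ascent_nodes s T True"
      define Q where "Q c \<longleftrightarrow> (\<exists>i. in_child T c i a \<and> i \<noteq> entry s c)" for c
      define c where "c = (LEAST c. Q c)"
      have "\<exists>c. Q c" using a by (auto simp: ascent_nodes_def on_spine_def Q_def)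
      then have Q: "Q c" unfolding c_def by (rule LeastI_ex)
      have least: "\<not> Q b" if "b < c" for b using that unfolding c_def by (rule not_less_Least)
      obtain i where i: "in_child T c i a" "i \<noteq> entry s c" using Q by (auto simp: Q_def)
      have ac: "1 \<le> a" "a < c" "c \<le> length s"
        using in_child_less[OF T i(1)] in_child_labels[OF i(1)] lab by auto
      have "descendant T a c" using i by (auto simp: descendant_def)
      moreover have "\<not> in_child T c (entry s c) a" using in_child_unique[OF T i(1)] i(2) by blast
      moreover have "\<forall>b. c > b \<and> b > a \<and> descendant T a b \<longrightarrow> in_child T b (entry s b) a"
        using least unfolding Q_def descendant_def by blast
      moreover have "entry s a > 0 \<longrightarrow> is_child T a (entry s a) Leaf"
        using a by (simp add: ascent_nodes_def)
      ultimately have "(a, c) \<in> tree_ascents s T" using ac unfolding tree_ascents_def by blast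
      then show "a \<in> fst ` tree_ascents s T" by force
    qed
  qed
  ultimately have "card (tree_ascents s T) = card (ascent_nodes s T True)"
    using card_image by metis
  with card_ascent_nodes[OF T] show ?thesis by simp
qed

section \<open>The f-polynomial as a sum over trees\<close>

lemma finite_tree_ascents: "finite (tree_ascents s T)"
proof (rule finite_subset)
  show "tree_ascents s T \<subseteq> {..length s} \<times> {..length s}" by (auto simp: tree_ascents_def)
qed simp

lemma sum_Pow_power_card:
  fixes x :: "'a::comm_semiring_1"
  assumes "finite S"
  shows "(\<Sum>A\<in>Pow S. x ^ card A) = (1 + x) ^ card S"
  using prod_add[OF assms, of "\<lambda>_. x" "\<lambda>_. 1"] by (simp add: add.commute)

definition trees :: "nat list \<Rightarrow> ltree set" where
  "trees s = {T. decreasing_tree s T}"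

text \<open>
  The sum over the sets \<open>A\<close> of tree-ascents of \<open>T\<close> is \<open>(1 + t) ^ asc(T)\<close> by the binomial
  theorem. The hypothesis always holds (\<open>finite_trees\<close>).
\<close>

lemma f_poly_ascents:
  assumes "finite (trees s)"
  shows "f_poly s = (\<Sum>T\<in>trees s. [:1, 1:] ^ ascent_count T True)"
proof -
  define D where "D = Sigma (trees s) (\<lambda>T. Pow (tree_ascents s T))"
  define face where "face = (\<lambda>(T, A). interval s T (tree_plus s T A))"
  have D: "ascent_set s T A" if "(T, A) \<in> D" for T A
    using that by (auto simp: D_def trees_def intro: ascent_set.intro)
  have inj: "inj_on face D"
  proof (rule inj_onI, clarify)
    fix T A T' A' assume "(T, A) \<in> D" "(T', A') \<in> D" "face (T, A) = face (T', A')"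
    then show "T = T' \<and> A = A'" using pure_interval_inj[OF D D, of T A T' A'] unfolding face_def by simp
  qed
  have Perm: "Perm s = face ` D"
    unfolding Perm_def D_def face_def trees_def by force
  have dim: "face_dim s (face (T, A)) = card A" if TA: "(T, A) \<in> D" for T A
    unfolding face_dim_def
  proof (rule the_equality)
    show "\<exists>T' A'. decreasing_tree s T' \<and> A' \<subseteq> tree_ascents s T' \<and>
        face (T, A) = interval s T' (tree_plus s T' A') \<and> card A = card A'"
      using TA unfolding D_def face_def trees_def by auto
  next
    fix d assume "\<exists>T' A'. decreasing_tree s T' \<and> A' \<subseteq> tree_ascents s T' \<and>
        face (T, A) = interval s T' (tree_plus s T' A') \<and> d = card A'"
    then obtain T' A' where "(T', A') \<in> D" "face (T, A) = face (T', A')" "d = card A'"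
      unfolding D_def face_def trees_def by auto
    with inj TA show "d = card A" by (metis inj_onD prod.inject)
  qed
  have "f_poly s = (\<Sum>x\<in>D. monom 1 (face_dim s (face x)))"
    unfolding f_poly_def Perm by (simp add: sum.reindex[OF inj])
  also have "\<dots> = (\<Sum>(T, A)\<in>D. [:0, 1:] ^ card A)"
    by (rule sum.cong) (auto simp: dim monom_altdef)
  also have "\<dots> = (\<Sum>T\<in>trees s. \<Sum>A\<in>Pow (tree_ascents s T). [:0, 1:] ^ card A)"
    unfolding D_def by (rule sum.Sigma[symmetric]) (use assms finite_tree_ascents in auto)
  also have "\<dots> = (\<Sum>T\<in>trees s. [:1, 1:] ^ ascent_count T True)"
  proof (rule sum.cong[OF refl])
    fix T assume "T \<in> trees s"
    then have c: "card (tree_ascents s T) = ascent_count T True"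
      using card_tree_ascents by (simp add: trees_def)
    have "1 + [:0, 1:] = ([:1, 1:] :: int poly)" by (simp add: one_pCons)
    with c show "(\<Sum>A\<in>Pow (tree_ascents s T). [:0, 1:] ^ card A) = ([:1, 1:] :: int poly) ^ ascent_count T True"
      using sum_Pow_power_card[OF finite_tree_ascents, of "[:0, 1:] :: int poly" s T] by simp
  qed
  finally show ?thesis .
qed

section \<open>Contracting the edge between the two largest nodes\<close>

primrec children :: "ltree \<Rightarrow> ltree list" where
  "children Leaf = []"
| "children (Node y ts) = ts"

lemma labels_eq_Nil_iff: "labels t = [] \<longleftrightarrow> t = Leaf"
  by (cases t) auto

lemma decreasing_tree_Node:
  assumes "s \<noteq> []"
  shows "decreasing_tree s (Node (length s) ts) \<longleftrightarrow>
    distinct (concat (map labels ts)) \<and> length ts = entry s (length s) + 1 \<and>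
    (\<forall>t\<in>set ts. dtree s t) \<and> (\<Union>t\<in>set ts. set (labels t)) = {1..<length s}"
    (is "?l \<longleftrightarrow> ?r")
proof
  have n: "{1..length s} = insert (length s) {1..<length s}" using assms by (auto simp: Suc_le_eq)
  {
    assume l: ?l
    then have d: "dtree s (Node (length s) ts)" by (simp add: decreasing_tree_iff)
    then have "length s \<notin> (\<Union>t\<in>set ts. set (labels t))" by (auto simp: dtree_Node)
    moreover have "insert (length s) (\<Union>t\<in>set ts. set (labels t)) = insert (length s) {1..<length s}"
      using l n by (simp add: decreasing_tree_iff)
    ultimately have "(\<Union>t\<in>set ts. set (labels t)) = {1..<length s}"
      using insert_ident by (metis atLeastLessThan_iff less_irrefl)
    with d show ?r by (simp add: dtree_Node)
  }
  assume r: ?r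
  then have "a < length s" if "t \<in> set ts" "a \<in> set (labels t)" for t a
    using that by auto
  with r n show ?l by (auto simp: decreasing_tree_iff dtree_Node)
qed

lemma decreasing_tree_root:
  assumes "s \<noteq> []" "decreasing_tree s T"
  obtains ts where "T = Node (length s) ts"
proof -
  have T: "dtree s T" and lab: "set (labels T) = {1..length s}"
    using assms by (simp_all add: decreasing_tree_iff)
  have n: "length s \<in> set (labels T)" using assms(1) unfolding lab by (simp add: Suc_le_eq)
  then obtain y ts where y: "T = Node y ts" by (cases T) auto
  have "length s \<le> y" using n T label_le_root unfolding y by blast
  moreover have "y \<in> set (labels T)" unfolding y by simp
  then have "y \<le> length s" unfolding lab by simp
  ultimately show ?thesis using y that by simp
qed

lemma trees_Nil: "trees [] = {Leaf}"
proof -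
  have "decreasing_tree [] T \<longleftrightarrow> T = Leaf" for T
    by (cases "T = Leaf") (simp_all add: decreasing_tree_iff labels_eq_Nil_iff)
  then show ?thesis by (simp add: trees_def)
qed

lemma trees_singleton: "trees [v] = {Node 1 (replicate (v + 1) Leaf)}"
proof -
  have *: "decreasing_tree [v] (Node 1 ts) \<longleftrightarrow> ts = replicate (v + 1) Leaf" for ts
  proof
    assume "decreasing_tree [v] (Node 1 ts)"
    then have "length ts = v + 1" "(\<Union>t\<in>set ts. set (labels t)) = {}"
      using decreasing_tree_Node[of "[v]" ts] by (simp_all add: entry_def)
    then show "ts = replicate (v + 1) Leaf"
      by (intro replicate_eqI) (simp_all add: labels_eq_Nil_iff)
  next
    assume "ts = replicate (v + 1) Leaf"
    then show "decreasing_tree [v] (Node 1 ts)"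
      using decreasing_tree_Node[of "[v]" ts] by (simp add: entry_def)
  qed
  have "T \<in> trees [v] \<longleftrightarrow> T = Node 1 (replicate (v + 1) Leaf)" for T
  proof
    assume T: "T \<in> trees [v]"
    then obtain ts where "T = Node 1 ts" using decreasing_tree_root[of "[v]" T] by (auto simp: trees_def)
    with T * show "T = Node 1 (replicate (v + 1) Leaf)" by (simp add: trees_def)
  qed (use * in \<open>simp add: trees_def\<close>)
  then show ?thesis by blast
qed

lemma entry_append: "1 \<le> a \<Longrightarrow> a \<le> length s' \<Longrightarrow> entry (s' @ r) a = entry s' a"
  by (cases a) (simp_all add: entry_def nth_append)

lemma entry_last: "entry (s' @ [w]) (Suc (length s')) = w"
  "entry (s' @ [u, w]) (Suc (length s')) = u"
  "entry (s' @ [u, w]) (Suc (Suc (length s'))) = w"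
  by (simp_all add: entry_def nth_append)

lemma dtree_append:
  assumes "set (labels t) \<subseteq> {1..length s'}"
  shows "dtree (s' @ r) t \<longleftrightarrow> dtree (s' @ r') t"
  using assms by (intro dtree_cong) (auto simp: entry_append)

lemma decreasing_tree_split:
  assumes "length us = u + 1" "length as + length bs = v"
  shows "decreasing_tree (s' @ [u, v]) (Node (length s' + 2) (as @ Node (length s' + 1) us # bs)) \<longleftrightarrow>
    decreasing_tree (s' @ [u + v]) (Node (length s' + 1) (as @ us @ bs))"
proof -
  let ?k = "length s'"
  let ?L = "\<lambda>ts. \<Union>t\<in>set ts. set (labels t)"
  have l: "decreasing_tree (s' @ [u, v]) (Node (?k + 2) (as @ Node (?k + 1) us # bs)) \<longleftrightarrow>
      distinct (concat (map labels (as @ Node (?k + 1) us # bs))) \<and>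
      (\<forall>t\<in>set as \<union> set bs. dtree (s' @ [u, v]) t) \<and> dtree (s' @ [u, v]) (Node (?k + 1) us) \<and>
      insert (?k + 1) (?L (as @ us @ bs)) = {1..<?k + 2}"
    using decreasing_tree_Node[of "s' @ [u, v]" "as @ Node (?k + 1) us # bs"] assms
    by (auto simp: entry_last)
  have r: "decreasing_tree (s' @ [u + v]) (Node (?k + 1) (as @ us @ bs)) \<longleftrightarrow>
      distinct (concat (map labels (as @ us @ bs))) \<and>
      (\<forall>t\<in>set (as @ us @ bs). dtree (s' @ [u + v]) t) \<and> ?L (as @ us @ bs) = {1..?k}"
    using decreasing_tree_Node[of "s' @ [u + v]" "as @ us @ bs"] assms
    by (auto simp: entry_last atLeastLessThanSuc_atLeastAtMost)
  have mid: "dtree (s' @ [u, v]) (Node (?k + 1) us) \<longleftrightarrow> distinct (concat (map labels us)) \<and>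
      (\<forall>t\<in>set us. dtree (s' @ [u, v]) t \<and> (\<forall>a\<in>set (labels t). a < ?k + 1))"
    using assms by (simp add: dtree_Node entry_last)
  have dist: "distinct (concat (map labels (as @ Node (?k + 1) us # bs))) \<longleftrightarrow>
      ?k + 1 \<notin> ?L (as @ us @ bs) \<and> distinct (concat (map labels (as @ us @ bs)))"
    by auto
  have ivl: "{1..<?k + 2} = insert (?k + 1) {1..?k}" by auto
  have cong: "dtree (s' @ [u, v]) t \<longleftrightarrow> dtree (s' @ [u + v]) t"
    if "?L (as @ us @ bs) = {1..?k}" "t \<in> set (as @ us @ bs)" for t
    using that by (intro dtree_append) blast
  show ?thesis
  proof
    assume "decreasing_tree (s' @ [u, v]) (Node (?k + 2) (as @ Node (?k + 1) us # bs))"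
    then have *: "?k + 1 \<notin> ?L (as @ us @ bs)" "distinct (concat (map labels (as @ us @ bs)))"
      "\<forall>t\<in>set (as @ us @ bs). dtree (s' @ [u, v]) t"
      "insert (?k + 1) (?L (as @ us @ bs)) = insert (?k + 1) {1..?k}"
      unfolding l dist mid ivl by auto
    have L: "?L (as @ us @ bs) = {1..?k}" by (rule iffD1[OF insert_ident *(4)]) (use *(1) in simp_all)
    show "decreasing_tree (s' @ [u + v]) (Node (?k + 1) (as @ us @ bs))"
      unfolding r using *(2,3) cong[OF L] by (intro conjI ballI L) (simp_all only:)
  next
    assume "decreasing_tree (s' @ [u + v]) (Node (?k + 1) (as @ us @ bs))"
    then have *: "distinct (concat (map labels (as @ us @ bs)))"
      "\<forall>t\<in>set (as @ us @ bs). dtree (s' @ [u + v]) t"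
      and L: "?L (as @ us @ bs) = {1..?k}"
      unfolding r by blast+
    have d: "\<forall>t\<in>set (as @ us @ bs). dtree (s' @ [u, v]) t"
      using *(2) cong[OF L] by blast
    have "?k + 1 \<notin> ?L (as @ us @ bs)" unfolding L by simp
    moreover have "a < ?k + 1" if "t \<in> set us" "a \<in> set (labels t)" for t a
    proof -
      have "a \<in> ?L (as @ us @ bs)" using that by auto
      then show ?thesis unfolding L by simp
    qed
    moreover have "distinct (concat (map labels us))" using *(1) by simp
    ultimately show "decreasing_tree (s' @ [u, v]) (Node (?k + 2) (as @ Node (?k + 1) us # bs))"
      unfolding l dist mid ivl L using *(1) d by auto
  qed
qed

text \<open>
  The inverse of the contraction of the edge between the two largest nodes: of the children of
  the root, those with indices \<open>p, \<dots>, p + u\<close> are made the children of a new node \<open>k + 1\<close>,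
  which becomes the child with index \<open>p\<close> of the new root \<open>k + 2\<close>.
\<close>

definition split_root :: "nat \<Rightarrow> nat \<Rightarrow> ltree \<Rightarrow> nat \<Rightarrow> ltree" where
  "split_root k u T p = (let ts = children T in
     Node (k + 2) (take p ts @ Node (k + 1) (take (u + 1) (drop p ts)) # drop (p + u + 1) ts))"

lemma split_root_append:
  "length us = u + 1 \<Longrightarrow> split_root k u (Node y (as @ us @ bs)) (length as) =
     Node (k + 2) (as @ Node (k + 1) us # bs)"
  by (simp add: split_root_def)

lemma split_list_3:
  assumes "length ts = u + v + 1" "p \<le> v"
  obtains as us bs where "ts = as @ us @ bs" "length as = p" "length us = u + 1" "length bs = v - p"
proof (rule that)
  show "ts = take p ts @ take (u + 1) (drop p ts) @ drop (p + u + 1) ts"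
    by (metis add.assoc append_take_drop_id drop_drop add.commute)
qed (use assms in auto)

lemma tree_children:
  assumes "T \<in> trees (s' @ [w])"
  obtains ts where "T = Node (length s' + 1) ts" "length ts = w + 1"
    "(\<Union>t\<in>set ts. set (labels t)) = {1..length s'}"
proof -
  obtain ts where ts: "T = Node (length s' + 1) ts"
    using assms decreasing_tree_root[of "s' @ [w]" T] by (auto simp: trees_def)
  with that assms show ?thesis
    using decreasing_tree_Node[of "s' @ [w]" ts]
    by (auto simp: trees_def entry_last atLeastLessThanSuc_atLeastAtMost)
qed

lemma bij_betw_split_root:
  "bij_betw (\<lambda>(T, p). split_root (length s') u T p) (trees (s' @ [u + v]) \<times> {..v}) (trees (s' @ [u, v]))"
  unfolding bij_betw_def
proof
  let ?k = "length s'"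
  show "inj_on (\<lambda>(T, p). split_root ?k u T p) (trees (s' @ [u + v]) \<times> {..v})"
  proof (rule inj_onI, clarify)
    fix T p T' p'
    assume T: "T \<in> trees (s' @ [u + v])" "T' \<in> trees (s' @ [u + v])" and p: "p \<le> v" "p' \<le> v"
      and eq: "split_root ?k u T p = split_root ?k u T' p'"
    obtain ts where ts: "T = Node (?k + 1) ts" "length ts = u + v + 1"
      "(\<Union>t\<in>set ts. set (labels t)) = {1..?k}" using T(1) by (rule tree_children)
    obtain ts' where ts': "T' = Node (?k + 1) ts'" "length ts' = u + v + 1"
      "(\<Union>t\<in>set ts'. set (labels t)) = {1..?k}" using T(2) by (rule tree_children)
    obtain as us bs where a: "ts = as @ us @ bs" "length as = p" "length us = u + 1" "length bs = v - p"
      using ts(2) p(1) by (rule split_list_3)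
    obtain as' us' bs' where a': "ts' = as' @ us' @ bs'" "length as' = p'"
      "length us' = u + 1" "length bs' = v - p'"
      using ts'(2) p(2) by (rule split_list_3)
    have no: "Node (?k + 1) xs \<notin> set ts" "Node (?k + 1) xs \<notin> set ts'" for xs
    proof -
      have "?k + 1 \<notin> (\<Union>t\<in>set ts. set (labels t))" "?k + 1 \<notin> (\<Union>t\<in>set ts'. set (labels t))"
        using ts(3) ts'(3) by simp_all
      then show "Node (?k + 1) xs \<notin> set ts" "Node (?k + 1) xs \<notin> set ts'" by force+
    qed
    have e: "as @ Node (?k + 1) us # bs = as' @ Node (?k + 1) us' # bs'"
      using eq unfolding ts(1) ts'(1) a(1) a'(1) a(2)[symmetric] a'(2)[symmetric]
      by (simp add: split_root_append[OF a(3)] split_root_append[OF a'(3)] del: append_assoc)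
    then have "Node (?k + 1) us \<in> set (as' @ Node (?k + 1) us' # bs')" by (metis in_set_conv_decomp)
    then have u: "us = us'" using no(2) a'(1) by auto
    moreover have "as = as' \<and> bs = bs'"
      using e no(1)[of us] unfolding u a(1) by (subst (asm) append_Cons_eq_iff) auto
    ultimately show "T = T' \<and> p = p'" using ts ts' a a' by simp
  qed
  show "(\<lambda>(T, p). split_root ?k u T p) ` (trees (s' @ [u + v]) \<times> {..v}) = trees (s' @ [u, v])"
  proof (intro equalityI subsetI)
    fix X assume "X \<in> (\<lambda>(T, p). split_root ?k u T p) ` (trees (s' @ [u + v]) \<times> {..v})"
    then obtain T p where T: "T \<in> trees (s' @ [u + v])" and p: "p \<le> v" and X: "X = split_root ?k u T p"
      by auto
    obtain ts where ts: "T = Node (?k + 1) ts" "length ts = u + v + 1"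
      using T by (metis tree_children)
    obtain as us bs where a: "ts = as @ us @ bs" "length as = p" "length us = u + 1" "length bs = v - p"
      using ts(2) p by (rule split_list_3)
    have "X = Node (?k + 2) (as @ Node (?k + 1) us # bs)"
      unfolding X ts(1) a(1) a(2)[symmetric] by (rule split_root_append[OF a(3)])
    with T decreasing_tree_split[OF a(3), of as bs v s'] a p ts(1) show "X \<in> trees (s' @ [u, v])"
      by (simp add: trees_def)
  next
    fix X assume X: "X \<in> trees (s' @ [u, v])"
    then obtain cs where cs: "X = Node (?k + 2) cs"
      using decreasing_tree_root[of "s' @ [u, v]" X] by (auto simp: trees_def)
    have c: "length cs = v + 1" "\<forall>t\<in>set cs. dtree (s' @ [u, v]) t"
      "(\<Union>t\<in>set cs. set (labels t)) = {1..<?k + 2}"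
      using X decreasing_tree_Node[of "s' @ [u, v]" cs] unfolding cs by (auto simp: trees_def entry_last)
    have "?k + 1 \<in> (\<Union>t\<in>set cs. set (labels t))" unfolding c(3) by simp
    then obtain t where t: "t \<in> set cs" "?k + 1 \<in> set (labels t)" by blast
    then have "t \<noteq> Leaf" by auto
    then obtain y us where y: "t = Node y us" by (metis ltree.exhaust)
    have "?k + 1 \<le> y" using t c(2) label_le_root unfolding y by blast
    moreover have "y \<in> (\<Union>t\<in>set cs. set (labels t))" using t y by force
    then have "y < ?k + 2" unfolding c(3) by simp
    ultimately have yk: "y = ?k + 1" by simp
    have "dtree (s' @ [u, v]) t" using t c(2) by blast
    then have us: "length us = u + 1" unfolding y yk by (simp add: dtree_Node entry_last)
    obtain as bs where ab: "cs = as @ t # bs" using t(1) by (meson split_list)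
    have len: "length as + length bs = v" using c(1) ab by simp
    have "Node (?k + 1) (as @ us @ bs) \<in> trees (s' @ [u + v])"
      using X decreasing_tree_split[OF us len, of s'] unfolding cs ab y yk by (simp add: trees_def)
    moreover have "X = split_root ?k u (Node (?k + 1) (as @ us @ bs)) (length as)"
      unfolding cs ab y yk split_root_append[OF us] ..
    moreover have "length as \<le> v" using len by simp
    ultimately show "X \<in> (\<lambda>(T, p). split_root ?k u T p) ` (trees (s' @ [u + v]) \<times> {..v})"
      by force
  qed
qed

lemma finite_trees: "finite (trees s)"
proof (induction "length s" arbitrary: s rule: less_induct)
  case less
  consider "s = []" | v where "s = [v]" | s' u v where "s = s' @ [u, v]"
    by (cases s rule: rev_cases; metis append_Nil append.assoc append_Cons rev_exhaust)
  then show ?case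
  proof cases
    case 3
    then have "finite (trees (s' @ [u + v]))" by (intro less) simp
    then show ?thesis using bij_betw_finite[OF bij_betw_split_root[of s' u v]] 3 by simp
  qed (simp_all add: trees_Nil trees_singleton)
qed

lemma f_poly_eq: "f_poly s = (\<Sum>T\<in>trees s. [:1, 1:] ^ ascent_count T True)"
  by (rule f_poly_ascents[OF finite_trees])

lemma f_poly_singleton: "f_poly [v] = 1"
proof -
  have "ascent_count (Node 1 (replicate (v + 1) Leaf)) True = 0"
    using ascent_count_Node[of 1 "replicate v Leaf" Leaf True] by (simp add: replicate_append_same)
  then show ?thesis by (simp add: f_poly_eq trees_singleton)
qed

lemma ascent_count_split_root:
  assumes "length ts = u + v + 1" "p \<le> v"
  shows "ascent_count (split_root k u (Node y ts) p) True =
    ascent_count (Node y ts) True + (if p < v \<and> (u = 0 \<or> ts ! (p + u) = Leaf) then 1 else 0)"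
proof -
  obtain as us bs where a: "ts = as @ us @ bs" "length as = p" "length us = u + 1" "length bs = v - p"
    using assms by (rule split_list_3)
  obtain us0 x where us: "us = us0 @ [x]" "length us0 = u" using a(3) by (metis Suc_eq_plus1 length_Suc_conv_rev)
  have x: "ts ! (p + u) = x" using a us by (simp add: nth_append)
  have split: "split_root k u (Node y ts) p = Node (k + 2) (as @ Node (k + 1) us # bs)"
    unfolding a(1) a(2)[symmetric] by (rule split_root_append[OF a(3)])
  show ?thesis
  proof (cases bs rule: rev_cases)
    case Nil
    have "ascent_count (Node (k + 2) (as @ [Node (k + 1) (us0 @ [x])])) True =
        ascent_count (Node y ((as @ us0) @ [x])) True"
      unfolding ascent_count_Node by simp
    then show ?thesis using Nil a us unfolding split by simp
  next
    case (snoc bs0 z)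
    have main: "ascent_count (Node (k + 2) ((as @ Node (k + 1) (us0 @ [x]) # bs0) @ [z])) True =
        ascent_count (Node y ((as @ us0 @ [x] @ bs0) @ [z])) True +
        (if us0 = [] \<or> x = Leaf then 1 else 0)"
      unfolding ascent_count_Node by (simp add: ascent_count_Node)
    have node: "Node (k + 2) (as @ Node (k + 1) us # bs) =
        Node (k + 2) ((as @ Node (k + 1) (us0 @ [x]) # bs0) @ [z])"
      by (simp add: snoc us)
    have ts: "(as @ us0 @ [x] @ bs0) @ [z] = ts" by (simp add: a(1) us(1) snoc)
    have "p < v" using a(4) snoc by simp
    moreover have "us0 = [] \<longleftrightarrow> u = 0" using us(2) by auto
    ultimately show ?thesis unfolding split node main x ts by simp
  qed
qed

lemma decreasing_tree_insert_leaf: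
  assumes "length as + length bs = w + 1"
  shows "decreasing_tree (s' @ [w + 1]) (Node (length s' + 1) (as @ Leaf # bs)) \<longleftrightarrow>
    decreasing_tree (s' @ [w]) (Node (length s' + 1) (as @ bs))"
proof -
  let ?k = "length s'"
  let ?L = "\<lambda>ts. \<Union>t\<in>set ts. set (labels t)"
  have l: "decreasing_tree (s' @ [w + 1]) (Node (?k + 1) (as @ Leaf # bs)) \<longleftrightarrow>
      distinct (concat (map labels (as @ bs))) \<and>
      (\<forall>t\<in>set (as @ bs). dtree (s' @ [w + 1]) t) \<and> ?L (as @ bs) = {1..?k}"
    using decreasing_tree_Node[of "s' @ [w + 1]" "as @ Leaf # bs"] assms
    by (auto simp: entry_last atLeastLessThanSuc_atLeastAtMost)
  have r: "decreasing_tree (s' @ [w]) (Node (?k + 1) (as @ bs)) \<longleftrightarrow>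
      distinct (concat (map labels (as @ bs))) \<and>
      (\<forall>t\<in>set (as @ bs). dtree (s' @ [w]) t) \<and> ?L (as @ bs) = {1..?k}"
    using decreasing_tree_Node[of "s' @ [w]" "as @ bs"] assms
    by (auto simp: entry_last atLeastLessThanSuc_atLeastAtMost)
  have "dtree (s' @ [w + 1]) t \<longleftrightarrow> dtree (s' @ [w]) t"
    if "?L (as @ bs) = {1..?k}" "t \<in> set (as @ bs)" for t
    using that by (intro dtree_append) blast
  then show ?thesis unfolding l r by blast
qed

text \<open>
  Since \<open>q \<le> w\<close>, the child with index \<open>q\<close> is not the last of the \<open>w + 2\<close> children of the root,
  so deleting it does not affect the right spine.
\<close>

lemma sum_leaf_child:
  assumes "q \<le> w"
  shows "(\<Sum>T | T \<in> trees (s' @ [w + 1]) \<and> children T ! q = Leaf. [:1, 1:] ^ ascent_count T True) =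
    f_poly (s' @ [w])"
proof -
  let ?k = "length s'"
  define ins where "ins T = Node (?k + 1) (take q (children T) @ Leaf # drop q (children T))" for T
  define del where "del T = Node (?k + 1) (take q (children T) @ drop (q + 1) (children T))" for T
  have ins: "ins T \<in> trees (s' @ [w + 1]) \<and> children (ins T) ! q = Leaf \<and> del (ins T) = T \<and>
    ascent_count (ins T) True = ascent_count T True" if T: "T \<in> trees (s' @ [w])" for T
  proof -
    obtain ts where ts: "T = Node (?k + 1) ts" "length ts = w + 1" using T by (metis tree_children)
    define as bs where "as = take q ts" and "bs = drop q ts"
    have ab: "ts = as @ bs" "length as = q" "length bs = w + 1 - q"
      using ts assms by (simp_all add: as_def bs_def)
    have "bs \<noteq> []" using ab(3) assms by auto
    then obtain bs0 z where z: "bs = bs0 @ [z]" by (metis rev_exhaust)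
    have i: "ins T = Node (?k + 1) (as @ Leaf # bs)" by (simp add: ins_def ts as_def bs_def)
    have "ascent_count (Node (?k + 1) ((as @ Leaf # bs0) @ [z])) True =
      ascent_count (Node (?k + 1) ((as @ bs0) @ [z])) True"
      unfolding ascent_count_Node by simp
    moreover have "decreasing_tree (s' @ [w + 1]) (Node (?k + 1) (as @ Leaf # bs))"
      using T ts ab assms by (subst decreasing_tree_insert_leaf) (simp_all add: trees_def)
    ultimately show ?thesis
      using i ts ab z by (simp add: trees_def del_def nth_append)
  qed
  have del: "del T \<in> trees (s' @ [w]) \<and> ins (del T) = T"
    if T: "T \<in> trees (s' @ [w + 1])" "children T ! q = Leaf" for T
  proof -
    obtain ts where ts: "T = Node (?k + 1) ts" "length ts = w + 1 + 1"
      using T(1) by (metis tree_children)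
    define as bs where "as = take q ts" and "bs = drop (q + 1) ts"
    have ab: "ts = as @ Leaf # bs" "length as = q" "length bs = w + 1 - q"
      using ts assms T(2) id_take_nth_drop[of q ts] by (simp_all add: as_def bs_def)
    have "decreasing_tree (s' @ [w]) (Node (?k + 1) (as @ bs))"
      using T(1) ts ab assms decreasing_tree_insert_leaf[of as bs w s'] by (simp add: trees_def)
    moreover have "del T = Node (?k + 1) (as @ bs)" using ts as_def bs_def by (simp add: del_def)
    ultimately show ?thesis using ab ts by (simp add: trees_def ins_def)
  qed
  show ?thesis
    unfolding f_poly_eq
  proof (rule sum.reindex_bij_witness[of _ ins del])
    fix T assume T: "T \<in> {T. T \<in> trees (s' @ [w + 1]) \<and> children T ! q = Leaf}"
    then have d: "del T \<in> trees (s' @ [w])" "ins (del T) = T" using del by blast+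
    then show "ins (del T) = T" "del T \<in> trees (s' @ [w])" by blast+
    show "[:1, 1:] ^ ascent_count (del T) True = ([:1, 1:] :: int poly) ^ ascent_count T True"
      using ins[OF d(1)] d(2) by simp
  qed (use ins in blast)+
qed

section \<open>The recurrences\<close>

lemma f_poly_split:
  "f_poly (s' @ [u, v]) = (\<Sum>T\<in>trees (s' @ [u + v]). \<Sum>p\<le>v.
     [:1, 1:] ^ ascent_count T True * (if p < v \<and> (u = 0 \<or> children T ! (p + u) = Leaf) then [:1, 1:] else 1))"
proof -
  have "f_poly (s' @ [u, v]) =
      (\<Sum>(T, p)\<in>trees (s' @ [u + v]) \<times> {..v}. [:1, 1:] ^ ascent_count (split_root (length s') u T p) True)"
    unfolding f_poly_eq by (subst sum.reindex_bij_betw[OF bij_betw_split_root, symmetric])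
      (simp add: case_prod_unfold)
  also have "\<dots> = (\<Sum>T\<in>trees (s' @ [u + v]). \<Sum>p\<le>v. [:1, 1:] ^ ascent_count (split_root (length s') u T p) True)"
    by (simp add: sum.cartesian_product)
  also have "\<dots> = (\<Sum>T\<in>trees (s' @ [u + v]). \<Sum>p\<le>v.
     [:1, 1:] ^ ascent_count T True * (if p < v \<and> (u = 0 \<or> children T ! (p + u) = Leaf) then [:1, 1:] else 1))"
  proof (intro sum.cong refl)
    fix T p assume T: "T \<in> trees (s' @ [u + v])" and p: "p \<in> {..v}"
    obtain ts where ts: "T = Node (length s' + 1) ts" "length ts = u + v + 1"
      using T by (metis tree_children)
    then show "[:1, 1:] ^ ascent_count (split_root (length s') u T p) True =
      ([:1, 1:] :: int poly) ^ ascent_count T True * (if p < v \<and> (u = 0 \<or> children T ! (p + u) = Leaf) then [:1, 1:] else 1)"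
      using ascent_count_split_root[OF ts(2)] p by simp
  qed
  finally show ?thesis .
qed

lemma f_poly_recurrence_zero:
  "f_poly (s' @ [0, v]) = f_poly (s' @ [v]) * (1 + of_nat v * [:1, 1:])"
proof -
  have "(\<Sum>p\<le>v. if p < v then [:1, 1:] else 1) = (1 + of_nat v * [:1, 1:] :: int poly)"
    by (simp add: lessThan_Suc_atMost[symmetric])
  then have "f_poly (s' @ [0, v]) = (\<Sum>T\<in>trees (s' @ [v]). [:1, 1:] ^ ascent_count T True
      * (1 + of_nat v * [:1, 1:]))"
    unfolding f_poly_split by (simp add: sum_distrib_left[symmetric])
  then show ?thesis by (simp add: f_poly_eq sum_distrib_right)
qed

lemma f_poly_recurrence_pos:
  assumes "u > 0 \<or> s' = []"
  shows "f_poly (s' @ [u, v]) = of_nat (v + 1) * f_poly (s' @ [u + v]) +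
    of_nat v * [:0, 1:] * f_poly (s' @ [u + v - 1])"
proof -
  let ?X = "[:1, 1:] :: int poly"
  let ?S = "trees (s' @ [u + v])"
  \<comment> \<open>If \<open>s'\<close> is empty then all children of the contracted root are leaves.\<close>
  have leaf: "u = 0 \<or> children T ! (p + u) = Leaf \<longleftrightarrow> children T ! (p + u) = Leaf"
    if T: "T \<in> ?S" and p: "p < v" for T p
  proof (cases "s' = []")
    case True
    obtain ts where ts: "T = Node (length s' + 1) ts" "length ts = u + v + 1"
      "(\<Union>t\<in>set ts. set (labels t)) = {1..length s'}" using T by (rule tree_children)
    have "ts ! (p + u) \<in> set ts" using ts(2) p by simp
    with ts(3) True have "set (labels (ts ! (p + u))) = {}" by auto
    then show ?thesis using ts(1) by (simp add: labels_eq_Nil_iff)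
  qed (use assms in simp)
  have "f_poly (s' @ [u, v]) = (\<Sum>T\<in>?S. \<Sum>p\<le>v. ?X ^ ascent_count T True +
      (if p < v \<and> children T ! (p + u) = Leaf then [:0, 1:] * ?X ^ ascent_count T True else 0))"
    unfolding f_poly_split
  proof (intro sum.cong refl)
    fix T p assume "T \<in> ?S" "p \<in> {..v}"
    have "?X = 1 + [:0, 1:]" by (simp add: one_pCons)
    with leaf[of T p] \<open>T \<in> ?S\<close>
    show "?X ^ ascent_count T True * (if p < v \<and> (u = 0 \<or> children T ! (p + u) = Leaf) then ?X else 1) =
      ?X ^ ascent_count T True +
      (if p < v \<and> children T ! (p + u) = Leaf then [:0, 1:] * ?X ^ ascent_count T True else 0)"
      by (auto simp: algebra_simps)
  qed
  also have "\<dots> = (\<Sum>p\<le>v. \<Sum>T\<in>?S. ?X ^ ascent_count T True +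
      (if p < v \<and> children T ! (p + u) = Leaf then [:0, 1:] * ?X ^ ascent_count T True else 0))"
    by (rule sum.swap)
  also have "\<dots> = (\<Sum>p\<le>v. f_poly (s' @ [u + v]) + (if p < v then [:0, 1:] * f_poly (s' @ [u + v - 1]) else 0))"
  proof (intro sum.cong refl)
    fix p assume "p \<in> {..v}"
    have "(\<Sum>T\<in>?S. if p < v \<and> children T ! (p + u) = Leaf then [:0, 1:] * ?X ^ ascent_count T True else 0) =
       (if p < v then [:0, 1:] * f_poly (s' @ [u + v - 1]) else 0)"
    proof (cases "p < v")
      case True
      then obtain w where w: "u + v = w + 1" "p + u \<le> w" by (cases v) auto
      have "(\<Sum>T\<in>?S. if children T ! (p + u) = Leaf then [:0, 1:] * ?X ^ ascent_count T True else 0) =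
        (\<Sum>T | T \<in> ?S \<and> children T ! (p + u) = Leaf. [:0, 1:] * ?X ^ ascent_count T True)"
        by (simp add: sum.If_cases finite_trees Int_def)
      also have "\<dots> = [:0, 1:] * (\<Sum>T | T \<in> ?S \<and> children T ! (p + u) = Leaf. ?X ^ ascent_count T True)"
        by (simp only: sum_distrib_left)
      also have "\<dots> = [:0, 1:] * f_poly (s' @ [u + v - 1])"
        unfolding w(1) sum_leaf_child[OF w(2)] by (simp only: add_diff_cancel_right')
      finally show ?thesis using True by simp
    qed simp
    then show "(\<Sum>T\<in>?S. ?X ^ ascent_count T True +
      (if p < v \<and> children T ! (p + u) = Leaf then [:0, 1:] * ?X ^ ascent_count T True else 0)) =
      f_poly (s' @ [u + v]) + (if p < v then [:0, 1:] * f_poly (s' @ [u + v - 1]) else 0)"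
      by (simp add: sum.distrib f_poly_eq)
  qed
  also have "\<dots> = of_nat (v + 1) * f_poly (s' @ [u + v]) + of_nat v * [:0, 1:] * f_poly (s' @ [u + v - 1])"
    by (simp add: sum.distrib lessThan_Suc_atMost[symmetric] algebra_simps)
  finally show ?thesis .
qed

theorem proposition2p5:
  fixes s :: "nat list"
  shows "(length s = 1 \<longrightarrow> f_poly s = 1) \<and>
    (\<forall>s' u v. length s \<ge> 2 \<and> s = s' @ [u, v] \<longrightarrow>
      (length s > 2 \<and> u = 0 \<longrightarrow> f_poly s = f_poly (s' @ [v]) * f_poly [0, v]) \<and>
      (length s = 2 \<or> u > 0 \<longrightarrow>
        f_poly s = of_nat (v + 1) * f_poly (s' @ [u + v]) +
          (if v = 0 then 0 else of_nat v * [:0, 1:] * f_poly (s' @ [u + v - 1]))))"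
proof (intro conjI allI impI)
  assume "length s = 1"
  then obtain v where "s = [v]" by (auto simp: length_Suc_conv)
  then show "f_poly s = 1" by (simp add: f_poly_singleton)
next
  fix s' u v assume s: "length s \<ge> 2 \<and> s = s' @ [u, v]" and "length s > 2 \<and> u = 0"
  then have "f_poly s = f_poly (s' @ [v]) * (1 + of_nat v * [:1, 1:])"
    using f_poly_recurrence_zero by simp
  moreover have "f_poly [0, v] = 1 + of_nat v * [:1, 1:]"
    using f_poly_recurrence_zero[of "[]" v] by (simp add: f_poly_singleton)
  ultimately show "f_poly s = f_poly (s' @ [v]) * f_poly [0, v]" by simp
next
  fix s' u v assume s: "length s \<ge> 2 \<and> s = s' @ [u, v]" and "length s = 2 \<or> u > 0"
  then have "u > 0 \<or> s' = []" by auto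
  with s show "f_poly s = of_nat (v + 1) * f_poly (s' @ [u + v]) +
          (if v = 0 then 0 else of_nat v * [:0, 1:] * f_poly (s' @ [u + v - 1]))"
    using f_poly_recurrence_pos[of u s' v] by simp
qed

end
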